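(* Let $\Omega\subset\mathbb R^n$ be a bounded domain, $1\le m\le n$, $f:\bar\Omega\times[0,\infty)\to\mathbb R$, and $\varphi$ a function on $(\Omega\times\{0\})\cup(\partial\Omega\times[0,\infty))$. Let $\mathbf f\in C(\bar\Omega)$ and $\Phi\in C(\partial\Omega)$. Assume: (i) $f\ge\nu_m$ for some constant $\nu_m>0$, and $\varphi(\cdot,0)$ is $C^2$ in $\Omega$ with a point $x_0\in\Omega$ such that $\varphi_{xx}(x_0,0)$ is $(m-1)$-positive; (ii) there exists $u\in C^{2,1}(\bar\Omega\times[0,\infty))$ with $E_m[u]=f$ in $\Omega\times(0,\infty)$ and $u=\varphi$ on $(\Omega\times\{0\})\cup(\partial\Omega\times[0,\infty))$; (iii) there exists an $m$-admissible $\mathbf u\in C^2(\bar\Omega)$ with $T_m(\mathbf u_{xx})=\mathbf f$ in $\Omega$ and $\mathbf u=\Phi$ on $\partial\Omega$; (iv) $\sup_{x\in\bar\Omega}|f(x,t)-\mathbf f(x)|\to0$ and $\sup_{x\in\partial\Omega}|\varphi(x,t)-\Phi(x)|\to0$ as $t\to\infty$. Then $\sup_{x\in\bar\Omega}|u(x,t)-\mathbf u(x)|\to0$ as $t\to\infty$.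
   Context: For $S\in\mathrm{Sym}(n)$ and $0\le p\le n$, $T_p(S)$ is the sum of all principal $p\times p$ minors of $S$, with $T_0(S)=1$. For $1\le k\le n$, $K_k=\{S\in\mathrm{Sym}(n):T_p(S)>0,\ p=1,\dots,k\}$; $S$ is $k$-positive if $S\in K_k$; by convention every matrix is $0$-positive. For $u(x,t)$, $u_{xx}$ is its Hessian in $x$ and $E_m[u]=-u_t\,T_{m-1}(u_{xx})+T_m(u_{xx})$. A function $\mathbf u\in C^2(\bar\Omega)$ is $m$-admissible if $\mathbf u_{xx}(x)\in K_m$ for every $x\in\bar\Omega$. *)

theory Defs
  imports "HOL-Analysis.Analysis"
begin

definition principal_minor :: "real^'n^'n \<Rightarrow> 'n set \<Rightarrow> real" where
  "principal_minor S I =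
     (\<Sum>\<pi> | \<pi> permutes I. of_int (sign \<pi>) * (\<Prod>i\<in>I. S $ i $ \<pi> i))"

definition T :: "nat \<Rightarrow> real^'n^'n \<Rightarrow> real" where
  "T p S = (\<Sum>I | card I = p. principal_minor S I)"

definition K :: "nat \<Rightarrow> (real^'n^'n) set" where
  "K k = {S. transpose S = S \<and> (\<forall>p\<in>{1..k}. T p S > 0)}"

definition k_positive :: "nat \<Rightarrow> real^'n^'n \<Rightarrow> bool" where
  "k_positive k S \<longleftrightarrow> k = 0 \<or> S \<in> K k"

text \<open>U is C^2 on the closure of the open set \<Omega>, with gradient DU and Hessian HU
  (derivatives taken in \<Omega>, all continuously extended to the closure).\<close>
definition C2_with :: "(real^'n) set \<Rightarrow> (real^'n \<Rightarrow> real) \<Rightarrow> (real^'n \<Rightarrow> real^'n)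
    \<Rightarrow> (real^'n \<Rightarrow> real^'n^'n) \<Rightarrow> bool" where
  "C2_with \<Omega> U DU HU \<longleftrightarrow>
     (\<forall>x\<in>\<Omega>. (U has_derivative (\<lambda>h. DU x \<bullet> h)) (at x) \<and>
              (DU has_derivative (\<lambda>h. HU x *v h)) (at x)) \<and>
     continuous_on (closure \<Omega>) U \<and> continuous_on (closure \<Omega>) DU \<and>
     continuous_on (closure \<Omega>) HU"

text \<open>u(x,t) is C^{2,1} on closure(\<Omega>) x [0,\<infinity>), with spatial gradient Du,
  spatial Hessian Hu and time derivative Ut (derivatives taken in \<Omega> x (0,\<infinity>),
  all continuously extended to closure(\<Omega>) x [0,\<infinity>)).\<close>
definition C21_with :: "(real^'n) set \<Rightarrow> (real^'n \<Rightarrow> real \<Rightarrow> real)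
    \<Rightarrow> (real^'n \<Rightarrow> real \<Rightarrow> real^'n) \<Rightarrow> (real^'n \<Rightarrow> real \<Rightarrow> real^'n^'n)
    \<Rightarrow> (real^'n \<Rightarrow> real \<Rightarrow> real) \<Rightarrow> bool" where
  "C21_with \<Omega> u Du Hu Ut \<longleftrightarrow>
     (\<forall>x\<in>\<Omega>. \<forall>t>0.
        ((\<lambda>y. u y t) has_derivative (\<lambda>h. Du x t \<bullet> h)) (at x) \<and>
        ((\<lambda>y. Du y t) has_derivative (\<lambda>h. Hu x t *v h)) (at x) \<and>
        ((\<lambda>s. u x s) has_real_derivative Ut x t) (at t)) \<and>
     continuous_on (closure \<Omega> \<times> {0..}) (\<lambda>(x, t). u x t) \<and>
     continuous_on (closure \<Omega> \<times> {0..}) (\<lambda>(x, t). Du x t) \<and>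
     continuous_on (closure \<Omega> \<times> {0..}) (\<lambda>(x, t). Hu x t) \<and>
     continuous_on (closure \<Omega> \<times> {0..}) (\<lambda>(x, t). Ut x t)"

end

theory Submission
  imports Defs "HOL-Computational_Algebra.Fundamental_Theorem_Algebra"
begin

text \<open>The polynomial \<open>(a + z) det (S + z I)\<close> and its derivatives have no zeros in the closed upper
  half-plane when \<open>Im a > 0\<close> and \<open>Im S\<close> is positive definite; hence \<open>a T\<^sub>m\<^sub>-\<^sub>1(S) + T\<^sub>m(S)\<close> is hyperbolic
  in every positive definite direction. This gives the Garding cone of the operator: it is a union
  of components of the set where the operator is positive, and the operator is monotone on it. Since
  \<open>f > 0\<close> and \<open>\<Omega> \<times> [0, \<infinity>)\<close> is connected, the solution stays in the cone once it is there at one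
  point. It is then compared with the barriers \<open>U(x) \<plusminus> s(t) g(x)\<close>, where \<open>g\<close> is a concave quadratic
  and \<open>s(t) = \<epsilon> + M exp (- \<kappa> (t - t\<^sub>0))\<close> decays so slowly that the time derivative costs at most half of
  the gain in the operator obtained from shifting the Hessian by \<open>s I\<close>.\<close>

text \<open>Neither \<open>u\<close> nor its initial datum is assumed admissible, and positivity of
  the operator alone does not make it elliptic: ellipticity has to be extracted from the sign of
  \<open>f\<close> and the (m-1)-positivity at a single point. The second obstacle is that the time
  derivative is multiplied by \<open>gT (m - 1)\<close> of the Hessian, which is not controlled in
  advance. The gain from a shift must therefore be measured by the same factor, at the shifted
  matrix: on the cone, T_m(S + s I) exceeds T_m(S) by at least s/m times T_{m-1}(S + s I). One half,
  s/(2m), fixes the decay rate, since \<open>g \<le> G\<close> and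
  \<open>\<kappa> = 1 / (2 * m * G)\<close> give \<open>- s' * g \<le> s / (2 * m)\<close>. The
  other half, through the positive minimum of \<open>gT (m - 1)\<close> over the Hessians of
  \<open>U\<close>, absorbs the difference between \<open>f\<close> and its limit. The constant
  \<open>\<epsilon>\<close> in \<open>s\<close> keeps this reserve and the boundary margin from
  dying out in time.\<close>

section \<open>Elementary symmetric functions and the characteristic polynomial\<close>

text \<open>The paper's \<open>T\<^sub>p\<close> over an arbitrary commutative ring, so that it can also be evaluated at
  complex matrices and at matrices of polynomials.\<close>

definition gminor :: "'a::comm_ring_1^'n^'n \<Rightarrow> 'n set \<Rightarrow> 'a" where
  "gminor S I = (\<Sum>\<pi> | \<pi> permutes I. of_int (sign \<pi>) * (\<Prod>i\<in>I. S $ i $ \<pi> i))"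

definition gT :: "nat \<Rightarrow> 'a::comm_ring_1^'n^'n \<Rightarrow> 'a" where
  "gT p S = (\<Sum>I | card I = p. gminor S I)"

text \<open>\<open>gE m a S\<close> is \<open>T\<^sub>m\<close> of the block diagonal matrix with blocks \<open>a\<close> and \<open>S\<close>; the operator
  \<open>E\<^sub>m[u]\<close> is \<open>gE m (- u\<^sub>t) u\<^sub>x\<^sub>x\<close>.\<close>

definition gE :: "nat \<Rightarrow> 'a::comm_ring_1 \<Rightarrow> 'a^'n^'n \<Rightarrow> 'a" where
  "gE m a S = a * gT (m - 1) S + gT m S"

lemma T_eq_gT: "T p S = gT p S"
  by (simp add: T_def gT_def principal_minor_def gminor_def)

lemma gT_0 [simp]: "gT 0 S = 1"
proof -
  have "{I::'b set. card I = 0} = {{}}" by auto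
  then show ?thesis
    by (simp add: gT_def gminor_def)
qed

text \<open>In each product of the Leibniz formula, let \<open>I\<close> be the set of rows
  contributing an entry of \<open>M\<close>. The other rows contribute a diagonal \<open>x\<close>,
  so only permutations of \<open>I\<close> survive, and their signed sum is the principal minor on
  \<open>I\<close>.\<close>

lemma det_add_scalar:
  fixes M :: "'a::comm_ring_1^'n^'n"
  shows "det (\<chi> i j. M $ i $ j + (if i = j then x else 0)) =
         (\<Sum>k\<le>CARD('n). gT k M * x ^ (CARD('n) - k))"
proof -
  have prod_delta: "(\<Prod>i\<in>UNIV - I. if i = \<pi> i then x else 0) =
       (if \<pi> permutes I then x ^ (CARD('n) - card I) else 0)"
    if "\<pi> permutes (UNIV :: 'n set)" for \<pi> and I :: "'n set"
  proof (cases "\<forall>i\<in>UNIV - I. i = \<pi> i")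
    case True
    then have p: "\<pi> permutes I"
      using that by (intro permutes_superset[OF that]) auto
    have "(\<Prod>i\<in>UNIV - I. if i = \<pi> i then x else 0) = (\<Prod>i\<in>UNIV - I. x)"
      using True by (intro prod.cong) auto
    also have "\<dots> = x ^ (CARD('n) - card I)"
      by (simp add: card_Diff_subset)
    finally show ?thesis using p by simp
  next
    case False
    then obtain i where i: "i \<in> UNIV - I" "i \<noteq> \<pi> i" by blast
    then have "(\<Prod>i\<in>UNIV - I. if i = \<pi> i then x else 0) = 0"
      by (intro prod_zero) auto
    moreover have "\<not> \<pi> permutes I" using i by (auto simp: permutes_def)
    ultimately show ?thesis by simp
  qed
  have "det (\<chi> i j. M $ i $ j + (if i = j then x else 0)) =
     (\<Sum>\<pi> | \<pi> permutes (UNIV::'n set). of_int (sign \<pi>) *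
        (\<Prod>i\<in>UNIV. M $ i $ \<pi> i + (if i = \<pi> i then x else 0)))"
    by (simp add: det_def)
  also have "\<dots> = (\<Sum>\<pi> | \<pi> permutes (UNIV::'n set). \<Sum>I\<in>Pow UNIV. of_int (sign \<pi>) *
        ((\<Prod>i\<in>I. M $ i $ \<pi> i) * (if \<pi> permutes I then x ^ (CARD('n) - card I) else 0)))"
    by (intro sum.cong refl) (simp add: prod_add sum_distrib_left prod_delta)
  also have "\<dots> = (\<Sum>I\<in>Pow UNIV. \<Sum>\<pi> | \<pi> permutes (UNIV::'n set). of_int (sign \<pi>) *
        ((\<Prod>i\<in>I. M $ i $ \<pi> i) * (if \<pi> permutes I then x ^ (CARD('n) - card I) else 0)))"
    by (rule sum.swap)
  also have "\<dots> = (\<Sum>I\<in>Pow UNIV. gminor M I * x ^ (CARD('n) - card I))"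
  proof (intro sum.cong refl)
    fix I :: "'n set"
    have "(\<Sum>\<pi> | \<pi> permutes (UNIV::'n set). of_int (sign \<pi>) *
        ((\<Prod>i\<in>I. M $ i $ \<pi> i) * (if \<pi> permutes I then x ^ (CARD('n) - card I) else 0))) =
       (\<Sum>\<pi> | \<pi> permutes I. of_int (sign \<pi>) *
        ((\<Prod>i\<in>I. M $ i $ \<pi> i) * x ^ (CARD('n) - card I)))"
      by (rule sum.mono_neutral_cong_right)
         (auto simp: finite_permutations intro: permutes_subset)
    then show "(\<Sum>\<pi> | \<pi> permutes (UNIV::'n set). of_int (sign \<pi>) *
        ((\<Prod>i\<in>I. M $ i $ \<pi> i) * (if \<pi> permutes I then x ^ (CARD('n) - card I) else 0))) =
        gminor M I * x ^ (CARD('n) - card I)"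
      by (simp add: gminor_def sum_distrib_right mult.assoc)
  qed
  also have "\<dots> = (\<Sum>k\<le>CARD('n). \<Sum>I | I \<in> Pow UNIV \<and> card I = k. gminor M I * x ^ (CARD('n) - card I))"
    by (rule sum.group[symmetric]) (auto intro: card_mono)
  also have "\<dots> = (\<Sum>k\<le>CARD('n). gT k M * x ^ (CARD('n) - k))"
    by (intro sum.cong refl) (simp add: gT_def sum_distrib_right)
  finally show ?thesis .
qed

text \<open>This is det(M + x I), the characteristic polynomial of -M. Writing it by coefficients
  avoids determinants of polynomial matrices.\<close>

definition cpoly :: "'a::comm_ring_1^'n^'n \<Rightarrow> 'a poly" where
  "cpoly M = (\<Sum>k\<le>CARD('n). monom (gT k M) (CARD('n) - k))"

lemma poly_cpoly:
  fixes M :: "'a::comm_ring_1^'n^'n"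
  shows "poly (cpoly M) x = det (\<chi> i j. M $ i $ j + (if i = j then x else 0))"
  by (simp add: cpoly_def det_add_scalar poly_sum poly_monom)

lemma coeff_cpoly:
  fixes M :: "'a::comm_ring_1^'n^'n"
  assumes "k \<le> CARD('n)"
  shows "coeff (cpoly M) (CARD('n) - k) = gT k M"
proof -
  have "coeff (cpoly M) (CARD('n) - k) = (\<Sum>j\<le>CARD('n). if j = k then gT j M else 0)"
    unfolding cpoly_def coeff_sum coeff_monom
    using assms by (intro sum.cong refl) auto
  then show ?thesis using assms by simp
qed

lemma degree_cpoly:
  fixes M :: "'a::comm_ring_1^'n^'n"
  shows "degree (cpoly M) = CARD('n)"
proof (rule antisym)
  show "degree (cpoly M) \<le> CARD('n)"
    unfolding cpoly_def
    by (intro degree_sum_le) (auto intro: order.trans[OF degree_monom_le])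
  have "coeff (cpoly M) (CARD('n)) = 1"
    using coeff_cpoly[of 0 M] by simp
  then show "CARD('n) \<le> degree (cpoly M)"
    by (intro le_degree) simp
qed

text \<open>The product is det(x I + D) for the block diagonal D with blocks \<open>a\<close> and
  \<open>S\<close>; D has size n + 1, which puts T_m(D) at index n + 1 - m.\<close>

lemma gE_coeff:
  fixes S :: "'a::comm_ring_1^'n^'n"
  assumes "1 \<le> m" "m \<le> CARD('n)"
  shows "coeff ([:a, 1:] * cpoly S) (CARD('n) + 1 - m) = gE m a S"
proof -
  obtain j where j: "CARD('n) + 1 - m = Suc j" "j = CARD('n) - m" using assms by (cases "CARD('n)+1-m") auto
  have "coeff (cpoly S) (Suc j) = gT (m - 1) S"
    using coeff_cpoly[of "m - 1" S] j assms by (simp add: Suc_diff_le)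
  moreover have "coeff (cpoly S) j = gT m S" using coeff_cpoly[of m S] j assms by simp
  ultimately show ?thesis unfolding j(1) by (simp add: gE_def)
qed

section \<open>Half-plane stability\<close>

text \<open>The quotient is the sum of 1/(z - w) over the zeros w. Each z - w lies in the open upper
  half-plane, so each term has negative imaginary part; the induction splits off one zero.\<close>

lemma Im_logarithmic_derivative:
  fixes p :: "complex poly"
  assumes "p \<noteq> 0" "\<And>z. poly p z = 0 \<Longrightarrow> Im z < 0" "0 \<le> Im z"
  shows "Im (poly (pderiv p) z / poly p z) \<le> 0 \<and>
         (0 < degree p \<longrightarrow> Im (poly (pderiv p) z / poly p z) < 0)"
  using assms(1,2)
proof (induction "degree p" arbitrary: p)
  case 0
  then have "pderiv p = 0" by (simp add: pderiv_eq_0_iff)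
  then show ?case using 0 by simp
next
  case (Suc d)
  have "\<not> constant (poly p)" using Suc by (simp add: constant_degree)
  then obtain w where w: "poly p w = 0" using fundamental_theorem_of_algebra by blast
  then obtain q where q: "p = [:-w, 1:] * q" by (metis poly_eq_0_iff_dvd dvdE)
  have q0: "q \<noteq> 0" using q Suc by auto
  have dq: "d = degree q" using Suc q q0 by (simp add: degree_mult_eq del: mult_pCons_left)
  have IH: "Im (poly (pderiv q) z / poly q z) \<le> 0"
    using Suc.hyps(1)[OF dq q0] Suc.prems(2) q by auto
  have zw: "z \<noteq> w" using Suc.prems(2)[OF w] assms(3) by auto
  have qz: "poly q z \<noteq> 0" using Suc.prems(2)[of z] assms(3) q by fastforce
  have "poly (pderiv p) z / poly p z = 1 / (z - w) + poly (pderiv q) z / poly q z"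
    using zw qz unfolding q pderiv_mult poly_add poly_mult
    by (simp add: pderiv_pCons field_simps)
  moreover have "Im (1 / (z - w)) < 0"
    using Suc.prems(2)[OF w] assms(3) zw
    by (auto simp: Im_divide divide_less_0_iff complex_eq_iff add_nonneg_eq_0_iff
             intro!: add_nonneg_pos)
  ultimately show ?case using IH by simp
qed

lemma pderiv_stable:
  fixes p :: "complex poly"
  assumes "p \<noteq> 0" "\<And>z. poly p z = 0 \<Longrightarrow> Im z < 0" "0 < degree p"
  shows "pderiv p \<noteq> 0" "poly (pderiv p) z = 0 \<Longrightarrow> Im z < 0"
proof -
  show "pderiv p \<noteq> 0" using assms by (simp add: pderiv_eq_0_iff)
  show "Im z < 0" if "poly (pderiv p) z = 0"
  proof (rule ccontr)
    assume "\<not> Im z < 0"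
    then show False using Im_logarithmic_derivative[OF assms(1,2), of z] assms(3) that by simp
  qed
qed

text \<open>The Gauss--Lucas argument: derivatives inherit a zero-free half-plane.\<close>

lemma coeff_stable_nz:
  fixes p :: "complex poly"
  assumes "p \<noteq> 0" "\<And>z. poly p z = 0 \<Longrightarrow> Im z < 0" "j \<le> degree p"
  shows "coeff p j \<noteq> 0"
proof -
  have "(pderiv ^^ j) p \<noteq> 0 \<and> (\<forall>z. poly ((pderiv ^^ j) p) z = 0 \<longrightarrow> Im z < 0)"
    using assms(3)
  proof (induction j)
    case 0 then show ?case using assms by simp
  next
    case (Suc j)
    then have "0 < degree ((pderiv ^^ j) p)" by (simp add: degree_higher_pderiv)
    then show ?case using Suc pderiv_stable[of "(pderiv ^^ j) p"] by auto
  qed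
  then have "poly ((pderiv ^^ j) p) 0 \<noteq> 0" by force
  then show ?thesis by (simp add: poly_0_coeff_0 coeff_higher_pderiv)
qed

definition posdef :: "real^'n^'n \<Rightarrow> bool" where
  "posdef Y \<longleftrightarrow> transpose Y = Y \<and> (\<forall>x. x \<noteq> 0 \<longrightarrow> x \<bullet> (Y *v x) > 0)"

definition psd :: "real^'n^'n \<Rightarrow> bool" where
  "psd Y \<longleftrightarrow> transpose Y = Y \<and> (\<forall>x. x \<bullet> (Y *v x) \<ge> 0)"

lemma symmetric_matrix_inner: "transpose X = X \<Longrightarrow> x \<bullet> (X *v y) = y \<bullet> (X *v (x::real^'n))"
  by (metis dot_lmul_matrix inner_commute vector_transpose_matrix)

text \<open>A kernel vector v = p + iq gives v*(X + iY + z I)v = 0. By symmetry v*Xv is real, so the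
  imaginary part reads <p,Yp> + <q,Yq> + Im z |v|^2 = 0, which is impossible for Im z >= 0.\<close>

lemma det_shift_stable:
  fixes X Y :: "real^'n^'n"
  assumes X: "transpose X = X" and Y: "posdef Y"
    and d: "det (\<chi> i j. Complex (X $ i $ j) (Y $ i $ j) + (if i = j then z else 0)) = 0"
  shows "Im z < 0"
proof (rule ccontr)
  assume "\<not> Im z < 0"
  then have b: "Im z \<ge> 0" by simp
  define M :: "complex^'n^'n" where
    "M = (\<chi> i j. Complex (X $ i $ j) (Y $ i $ j) + (if i = j then z else 0))"
  have "\<not> invertible M" using d invertible_det_nz[of M] by (simp add: M_def)
  then obtain v where v: "v \<noteq> 0" "M *v v = 0"
    by (auto simp: invertible_left_inverse matrix_left_invertible_ker)
  define p :: "real^'n" where "p = (\<chi> i. Re (v $ i))"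
  define q :: "real^'n" where "q = (\<chi> i. Im (v $ i))"
  have comp: "(\<Sum>j\<in>UNIV. (Complex (X $ i $ j) (Y $ i $ j) + (if i = j then z else 0)) * v $ j) = 0" for i
    using v(2) by (simp add: M_def matrix_vector_mult_def vec_eq_iff)
  have comp': "(\<Sum>j\<in>UNIV. Complex (X $ i $ j) (Y $ i $ j) * v $ j) + z * v $ i = 0" for i
    using comp[of i] by (simp add: distrib_right sum.distrib if_distrib[where f="\<lambda>x. x * _"] cong: if_cong)
  have re: "X *v p - Y *v q + Re z *\<^sub>R p - Im z *\<^sub>R q = 0"
    using arg_cong[OF comp', of Re]
    by (simp add: vec_eq_iff matrix_vector_mult_def p_def q_def sum_subtractf algebra_simps)
  have im: "X *v q + Y *v p + Re z *\<^sub>R q + Im z *\<^sub>R p = 0"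
    using arg_cong[OF comp', of Im]
    by (simp add: vec_eq_iff matrix_vector_mult_def p_def q_def sum.distrib algebra_simps)
  have "q \<bullet> (X *v p) - q \<bullet> (Y *v q) + Re z * (q \<bullet> p) - Im z * (q \<bullet> q) = 0"
    using arg_cong[OF re, of "\<lambda>w. q \<bullet> w"] by (simp add: inner_simps)
  moreover have "p \<bullet> (X *v q) + p \<bullet> (Y *v p) + Re z * (p \<bullet> q) + Im z * (p \<bullet> p) = 0"
    using arg_cong[OF im, of "\<lambda>w. p \<bullet> w"] by (simp add: inner_simps)
  ultimately have "p \<bullet> (Y *v p) + q \<bullet> (Y *v q) + Im z * (p \<bullet> p + q \<bullet> q) = 0"
    using symmetric_matrix_inner[OF X, of p q] by (simp add: inner_commute algebra_simps)
  moreover have "Im z * (p \<bullet> p + q \<bullet> q) \<ge> 0" using b by simp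
  moreover have "p \<bullet> (Y *v p) \<ge> 0" "q \<bullet> (Y *v q) \<ge> 0"
    using Y by (cases "p = 0"; cases "q = 0"; force simp: posdef_def)+
  ultimately have "p \<bullet> (Y *v p) = 0" "q \<bullet> (Y *v q) = 0" by linarith+
  then have "p = 0" "q = 0" using Y unfolding posdef_def by force+
  then have "v = 0" by (simp add: vec_eq_iff p_def q_def complex_eq_iff)
  then show False using v by simp
qed

lemma gE_stable:
  fixes X Y :: "real^'n^'n"
  assumes m: "1 \<le> m" "m \<le> CARD('n)" and X: "transpose X = X" and Y: "posdef Y" and b: "b > 0"
  shows "gE m (Complex a b) (\<chi> i j. Complex (X $ i $ j) (Y $ i $ j)) \<noteq> 0"
proof -
  define M :: "complex^'n^'n" where "M = (\<chi> i j. Complex (X $ i $ j) (Y $ i $ j))"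
  let ?p = "[:Complex a b, 1:] * cpoly M"
  have c0: "cpoly M \<noteq> 0" using degree_cpoly[of M] by auto
  have "coeff ?p (CARD('n) + 1 - m) \<noteq> 0"
  proof (rule coeff_stable_nz)
    show "?p \<noteq> 0" using c0 by (metis mult_eq_0_iff pCons_eq_0_iff one_neq_zero)
    show "CARD('n) + 1 - m \<le> degree ?p"
      using c0 m by (subst degree_mult_eq) (auto simp: degree_cpoly)
    fix z assume "poly ?p z = 0"
    then consider "Complex a b + z = 0" | "poly (cpoly M) z = 0"
      unfolding poly_mult mult_eq_0_iff by auto
    then show "Im z < 0"
    proof cases
      case 1
      then show ?thesis using b by (auto simp: complex_eq_iff)
    next
      case 2
      then show ?thesis using det_shift_stable[OF X Y, of z] by (simp add: poly_cpoly M_def)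
    qed
  qed
  then show ?thesis using gE_coeff[OF m, of "Complex a b" M] by (simp add: M_def)
qed

section \<open>Pencils and the Garding cone\<close>

text \<open>Needed for evaluation of polynomials and for the inclusion of the reals in the complex
  numbers, which together identify the real and complex values of a pencil.\<close>

lemma gT_hom:
  fixes h :: "'a::comm_ring_1 \<Rightarrow> 'b::comm_ring_1"
  assumes h1: "h 1 = 1" and ha: "\<And>x y. h (x + y) = h x + h y" and hm: "\<And>x y. h (x * y) = h x * h y"
  shows "h (gT p M) = gT p (\<chi> i j. h (M $ i $ j))"
proof -
  have h0: "h 0 = 0" using ha[of 0 0] by simp
  have hn: "h (- x) = - h x" for x using ha[of x "- x"] h0 by (simp add: eq_neg_iff_add_eq_0 add.commute)
  have hp: "h (prod f A) = (\<Prod>x\<in>A. h (f x))" for f :: "'c \<Rightarrow> 'a" and A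
    by (induction A rule: infinite_finite_induct) (simp_all add: h1 hm)
  have hsign: "h (of_int (sign \<pi>)) = of_int (sign \<pi>)" for \<pi> :: "'c \<Rightarrow> 'c"
    by (simp add: sign_def h1 hn)
  have hsum1: "h (sum f A) = (\<Sum>x\<in>A. h (f x))" for f :: "('c \<Rightarrow> 'c) \<Rightarrow> 'a" and A
    by (induction A rule: infinite_finite_induct) (simp_all add: h0 ha)
  have hsum2: "h (sum f A) = (\<Sum>x\<in>A. h (f x))" for f :: "'c set \<Rightarrow> 'a" and A
    by (induction A rule: infinite_finite_induct) (simp_all add: h0 ha)
  show ?thesis
    by (simp add: gT_def gminor_def hsum1 hsum2 hp hm hsign)
qed

lemma gE_hom:
  fixes h :: "'a::comm_ring_1 \<Rightarrow> 'b::comm_ring_1"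
  assumes "h 1 = 1" "\<And>x y. h (x + y) = h x + h y" "\<And>x y. h (x * y) = h x * h y"
  shows "h (gE m a M) = gE m (h a) (\<chi> i j. h (M $ i $ j))"
  by (simp add: gE_def assms gT_hom[of h])

lemma map_poly_of_real_add: "map_poly complex_of_real (p + q) = map_poly of_real p + map_poly of_real q"
  by (rule poly_eqI) (simp add: coeff_map_poly)

lemma map_poly_of_real_mult: "map_poly complex_of_real (p * q) = map_poly of_real p * map_poly of_real q"
  by (rule poly_eqI) (simp add: coeff_map_poly coeff_mult)

lemma poly_map_of_real: "poly (map_poly complex_of_real p) (of_real x) = of_real (poly p x)"
  by (induction p) (simp_all add: map_poly_pCons)

text \<open>The zeros are real and, by positivity on the half-line, negative. So p is a positive
  constant times factors x + r with r > 0, and multiplying by such a factor preserves positivity of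
  all coefficients.\<close>

lemma real_rooted_pos_coeffs:
  fixes p :: "real poly"
  assumes "\<And>z. poly (map_poly complex_of_real p) z = 0 \<Longrightarrow> Im z = 0"
    and "\<And>s. s \<ge> 0 \<Longrightarrow> poly p s > 0" and "k \<le> degree p"
  shows "coeff p k > 0"
  using assms
proof (induction "degree p" arbitrary: p k)
  case 0
  then show ?case using 0(3)[of 0] by (simp add: poly_0_coeff_0)
next
  case (Suc d)
  let ?c = "map_poly complex_of_real p"
  have "\<not> constant (poly ?c)" using Suc by (simp add: constant_degree degree_map_poly)
  then obtain z where z: "poly ?c z = 0" using fundamental_theorem_of_algebra by blast
  then have "z = of_real (Re z)" using Suc.prems(1)[of z] by (simp add: complex_eq_iff)
  then have r: "poly p (Re z) = 0" by (metis z poly_map_of_real of_real_eq_0_iff)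
  then obtain q where q: "p = [:- Re z, 1:] * q" by (metis poly_eq_0_iff_dvd dvdE)
  have rneg: "Re z < 0" using r Suc.prems(2)[of "Re z"] by force
  have q0: "q \<noteq> 0" using q Suc by auto
  have dq: "d = degree q" using Suc q q0 by (simp add: degree_mult_eq del: mult_pCons_left)
  have qpos: "poly q s > 0" if "s \<ge> 0" for s
    using Suc.prems(2)[OF that] rneg that unfolding q poly_mult
    by (auto simp: zero_less_mult_iff)
  have qroot: "Im w = 0" if "poly (map_poly complex_of_real q) w = 0" for w
    using Suc.prems(1)[of w] that unfolding q map_poly_of_real_mult poly_mult by simp
  note IH = Suc.hyps(1)[OF dq qroot qpos]
  have cp: "coeff p k = - Re z * coeff q k + (if k = 0 then 0 else coeff q (k - 1))"
    unfolding q by (cases k) (simp_all add: coeff_pCons)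
  show ?case
  proof (cases "k \<le> d")
    case True
    then have "- Re z * coeff q k > 0" "k \<noteq> 0 \<Longrightarrow> coeff q (k - 1) > 0"
      using IH dq rneg by (auto simp: mult_neg_pos)
    then show ?thesis unfolding cp by (cases "k = 0") auto
  next
    case False
    then have "k = Suc d" using Suc by simp
    then show ?thesis unfolding cp using IH[of d] dq by (simp add: coeff_eq_0)
  qed
qed

text \<open>Evaluating \<open>gE\<close> at linear polynomials makes s ->
  \<open>gE m (a + s * b) (S + s *\<^sub>R Y)\<close> a polynomial object, whose coefficients can be
  tested for sign and varied continuously.\<close>

definition pencil :: "nat \<Rightarrow> real \<Rightarrow> real^'n^'n \<Rightarrow> real \<Rightarrow> real^'n^'n \<Rightarrow> real poly" where
  "pencil m b Y a S = gE m [:a, b:] (\<chi> i j. [:S $ i $ j, Y $ i $ j:])"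

lemma poly_pencil: "poly (pencil m b Y a S) s = gE m (a + s * b) (S + s *\<^sub>R Y)"
proof -
  have "poly (pencil m b Y a S) s = gE m (poly [:a, b:] s) (\<chi> i j. poly [:S $ i $ j, Y $ i $ j:] s)"
    unfolding pencil_def by (subst gE_hom[of "\<lambda>p. poly p s"]) simp_all
  also have "(\<chi> i j. poly [:S $ i $ j, Y $ i $ j:] s) = S + s *\<^sub>R Y"
    by (simp add: vec_eq_iff)
  finally show ?thesis by simp
qed

lemma poly_pencil_complex:
  "poly (map_poly complex_of_real (pencil m b Y a S)) z =
   gE m (of_real a + z * of_real b) (\<chi> i j. of_real (S $ i $ j) + z * of_real (Y $ i $ j))"
proof -
  have "poly (map_poly complex_of_real (pencil m b Y a S)) z =
      gE m (poly (map_poly of_real [:a, b:]) z) (\<chi> i j. poly (map_poly of_real [:S $ i $ j, Y $ i $ j:]) z)"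
    unfolding pencil_def
    by (subst gE_hom[of "\<lambda>p. poly (map_poly complex_of_real p) z"])
       (simp_all add: map_poly_of_real_add map_poly_of_real_mult)
  then show ?thesis by (simp add: map_poly_pCons)
qed

lemma prod_linear_coeff:
  fixes f g :: "'i \<Rightarrow> 'a::comm_ring_1"
  assumes "finite I"
  shows "degree (\<Prod>i\<in>I. [:f i, g i:]) \<le> card I \<and> coeff (\<Prod>i\<in>I. [:f i, g i:]) (card I) = (\<Prod>i\<in>I. g i)"
  using assms
proof (induction I rule: finite_induct)
  case (insert x I)
  let ?q = "\<Prod>i\<in>I. [:f i, g i:]"
  have "degree ([:f x, g x:] * ?q) \<le> Suc (card I)"
    using insert by (intro order.trans[OF degree_mult_le]) (simp add: add_mono)
  moreover have "coeff ([:f x, g x:] * ?q) (Suc (card I)) = g x * (\<Prod>i\<in>I. g i)"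
    using insert by (simp add: coeff_eq_0)
  ultimately show ?case using insert by simp
qed simp

lemma gT_linear_coeff:
  fixes S Y :: "'a::comm_ring_1^'n^'n"
  shows "degree (gT p (\<chi> i j. [:S $ i $ j, Y $ i $ j:])) \<le> p"
    "coeff (gT p (\<chi> i j. [:S $ i $ j, Y $ i $ j:])) p = gT p Y"
proof -
  have *: "degree (\<Prod>i\<in>I. [:S $ i $ \<pi> i, Y $ i $ \<pi> i:]) \<le> card I"
     "coeff (\<Prod>i\<in>I. [:S $ i $ \<pi> i, Y $ i $ \<pi> i:]) (card I) = (\<Prod>i\<in>I. Y $ i $ \<pi> i)"
    for I :: "'n set" and \<pi>
    using prod_linear_coeff[of I "\<lambda>i. S $ i $ \<pi> i" "\<lambda>i. Y $ i $ \<pi> i"] by simp_all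
  show "degree (gT p (\<chi> i j. [:S $ i $ j, Y $ i $ j:])) \<le> p"
    unfolding gT_def gminor_def
    by (intro degree_sum_le)
       (auto simp: finite_permutations of_int_poly intro!: order.trans[OF degree_smult_le] *(1))
  show "coeff (gT p (\<chi> i j. [:S $ i $ j, Y $ i $ j:])) p = gT p Y"
    unfolding gT_def gminor_def coeff_sum
    by (intro sum.cong refl) (auto simp: of_int_poly *(2)[symmetric])
qed

lemma pencil_coeff:
  assumes "1 \<le> m"
  shows "degree (pencil m b Y a S) \<le> m" "coeff (pencil m b Y a S) m = gE m b Y"
proof -
  let ?M = "\<chi> i j. [:S $ i $ j, Y $ i $ j:]"
  obtain k where k: "m = Suc k" using assms by (cases m) auto
  have "degree ([:a, b:] * gT k ?M) \<le> Suc k"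
    using gT_linear_coeff(1)[of k S Y]
    by (intro order.trans[OF degree_mult_le]) (simp add: add_mono)
  then show "degree (pencil m b Y a S) \<le> m"
    unfolding pencil_def gE_def k
    by (intro degree_add_le) (use gT_linear_coeff(1)[of "Suc k" S Y] in auto)
  have "coeff ([:a, b:] * gT k ?M) (Suc k) = b * gT k Y"
    using gT_linear_coeff[of k S Y] by (simp add: coeff_eq_0)
  then show "coeff (pencil m b Y a S) m = gE m b Y"
    unfolding pencil_def gE_def k coeff_add gT_linear_coeff(2) by simp
qed

lemma continuous_coeff_mult:
  assumes "\<And>k. continuous_on X (\<lambda>x. coeff (f x) k)" "\<And>k. continuous_on X (\<lambda>x. coeff (g x) k)"
  shows "continuous_on X (\<lambda>x. coeff (f x * g x :: 'a::real_normed_field poly) k)"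
  unfolding coeff_mult by (intro continuous_intros assms)

lemma continuous_coeff_prod:
  assumes "\<And>i k. i \<in> I \<Longrightarrow> continuous_on X (\<lambda>x. coeff (f i x) k)"
  shows "continuous_on X (\<lambda>x. coeff (\<Prod>i\<in>I. f i x :: 'a::real_normed_field poly) k)"
  using assms
  by (induction I arbitrary: k rule: infinite_finite_induct) (simp_all add: continuous_coeff_mult)

lemma continuous_pencil_coeff:
  fixes \<sigma> :: "'x::topological_space \<Rightarrow> real^'n^'n"
  assumes "continuous_on X \<alpha>" "continuous_on X \<sigma>"
  shows "continuous_on X (\<lambda>x. coeff (pencil m b Y (\<alpha> x) (\<sigma> x)) k)"
proof -
  have lin: "continuous_on X (\<lambda>x. coeff [:f x, c:] k)" if "continuous_on X f" for f :: "'x \<Rightarrow> real" and c k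
    using that by (cases k) (simp_all add: coeff_pCons)
  have gT: "continuous_on X (\<lambda>x. coeff (gT p (\<chi> i j. [:\<sigma> x $ i $ j, Y $ i $ j:])) k)" for p k
    unfolding gT_def gminor_def coeff_sum
    by (intro continuous_on_sum continuous_coeff_mult continuous_coeff_prod continuous_on_const)
       (use assms in \<open>auto intro!: lin continuous_intros\<close>)
  show ?thesis
    unfolding pencil_def gE_def coeff_add
    by (intro continuous_on_add continuous_coeff_mult gT lin assms)
qed

lemma continuous_gE [continuous_intros]:
  fixes \<sigma> :: "'x::topological_space \<Rightarrow> real^'n^'n"
  assumes "continuous_on X \<alpha>" "continuous_on X \<sigma>"
  shows "continuous_on X (\<lambda>x. gE m (\<alpha> x) (\<sigma> x))"
  \<comment> \<open>The constant coefficient of a pencil is its value at s = 0 in any direction; the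
    zero direction is taken.\<close>
  using continuous_pencil_coeff[OF assms, of m 0 0 0]
  by (simp add: poly_0_coeff_0[symmetric] poly_pencil)

lemma continuous_gT [continuous_intros]:
  fixes \<sigma> :: "'x::topological_space \<Rightarrow> real^'n^'n"
  assumes "continuous_on X \<sigma>"
  shows "continuous_on X (\<lambda>x. gT m (\<sigma> x))"
  unfolding gT_def gminor_def
  by (intro continuous_intros assms)

lemma gT_scale: "gT p (\<chi> i j. c * M $ i $ j) = c ^ p * gT p (M :: 'a::comm_ring_1^'n^'n)"
proof -
  have "gminor (\<chi> i j. c * M $ i $ j) I = c ^ card I * gminor M I" for I
    by (simp add: gminor_def prod.distrib sum_distrib_left algebra_simps)
  then show ?thesis by (simp add: gT_def sum_distrib_left)
qed

lemma gE_scale: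
  assumes "1 \<le> m"
  shows "gE m (c * a) (\<chi> i j. c * M $ i $ j) = c ^ m * gE m a (M :: 'a::comm_ring_1^'n^'n)"
  using assms by (cases m) (simp_all add: gE_def gT_scale algebra_simps)

section \<open>Positivity of the operator on positive definite pairs\<close>

lemma posdef_mat1: "posdef (mat 1)"
  by (simp add: posdef_def transpose_mat)

lemma posdef_add_psd: "posdef Y \<Longrightarrow> psd P \<Longrightarrow> posdef (Y + P)"
  by (simp add: posdef_def psd_def transpose_def vec_eq_iff matrix_vector_mult_add_rdistrib
      inner_add_right add_pos_nonneg)

lemma psd_scale: "psd P \<Longrightarrow> 0 \<le> c \<Longrightarrow> psd (c *\<^sub>R P)"
  by (simp add: psd_def transpose_def vec_eq_iff scaleR_matrix_vector_assoc[symmetric])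

lemma posdef_scale: "posdef P \<Longrightarrow> 0 < c \<Longrightarrow> posdef (c *\<^sub>R P)"
  by (simp add: posdef_def transpose_def vec_eq_iff scaleR_matrix_vector_assoc[symmetric])

lemma posdef_imp_psd: "posdef P \<Longrightarrow> psd P"
  unfolding posdef_def psd_def
  by (metis inner_zero_left less_eq_real_def)

lemma transpose_add: "transpose (A + B) = transpose A + transpose (B::'a::plus^'n^'m)"
  by (simp add: transpose_def vec_eq_iff)

lemma transpose_scaleR: "transpose (c *\<^sub>R A) = c *\<^sub>R transpose (A::real^'n^'m)"
  by (simp add: transpose_def vec_eq_iff)

text \<open>This is \<open>gE_stable\<close> with zero real part: by homogeneity of degree
  \<open>m\<close>, multiplying the pair by the imaginary unit only multiplies the value by
  i^m.\<close>

lemma gE_posdef_nz: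
  fixes Y :: "real^'n^'n"
  assumes m: "1 \<le> m" "m \<le> CARD('n)" and Y: "posdef Y" and b: "b > 0"
  shows "gE m b Y \<noteq> 0"
proof
  assume 0: "gE m b Y = 0"
  have "gE m (Complex 0 b) (\<chi> i j. Complex ((0::real^'n^'n) $ i $ j) (Y $ i $ j)) \<noteq> 0"
    by (rule gE_stable[OF m _ Y b]) (simp add: transpose_def vec_eq_iff)
  moreover have "(\<chi> i j. Complex ((0::real^'n^'n) $ i $ j) (Y $ i $ j)) =
      (\<chi> i j. \<i> * (\<chi> i j. complex_of_real (Y $ i $ j)) $ i $ j)"
    by (simp add: vec_eq_iff complex_eq_iff)
  moreover have "Complex 0 b = \<i> * of_real b" by (simp add: complex_eq_iff)
  ultimately have "gE m (of_real b) (\<chi> i j. complex_of_real (Y $ i $ j)) \<noteq> 0"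
    using gE_scale[OF m(1), of \<i> "of_real b" "\<chi> i j. complex_of_real (Y $ i $ j)"] by auto
  then show False using gE_hom[of complex_of_real m b Y] 0 by simp
qed

lemma gminor_mat1: "gminor (mat 1 :: 'a::comm_ring_1^'n^'n) I = 1"
proof -
  have "(\<Sum>\<pi> | \<pi> permutes I. of_int (sign \<pi>) * (\<Prod>i\<in>I. (mat 1 :: 'a^'n^'n) $ i $ \<pi> i)) =
      (\<Sum>\<pi>\<in>{id}. of_int (sign \<pi>) * (\<Prod>i\<in>I. (mat 1 :: 'a^'n^'n) $ i $ \<pi> i))"
  proof (rule sum.mono_neutral_right)
    show "\<forall>\<pi>\<in>{\<pi>. \<pi> permutes I} - {id}. of_int (sign \<pi>) * (\<Prod>i\<in>I. (mat 1 :: 'a^'n^'n) $ i $ \<pi> i) = 0"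
    proof
      fix \<pi> assume p: "\<pi> \<in> {\<pi>. \<pi> permutes I} - {id}"
      then obtain i where "i \<in> I" "\<pi> i \<noteq> i"
        by (metis DiffE insertCI mem_Collect_eq permutes_not_in eq_id_iff)
      then have "(\<Prod>i\<in>I. (mat 1 :: 'a^'n^'n) $ i $ \<pi> i) = 0"
        by (intro prod_zero bexI[of _ i]) (auto simp: mat_def)
      then show "of_int (sign \<pi>) * (\<Prod>i\<in>I. (mat 1 :: 'a^'n^'n) $ i $ \<pi> i) = 0" by simp
    qed
  qed (auto simp: finite_permutations permutes_id)
  then show ?thesis by (simp add: gminor_def mat_def sign_id)
qed

text \<open>The segment from (1, I) to (b, Y) consists of positive definite pairs, where
  \<open>gE m\<close> has no zero; so the sign is that at (1, I), where all principal minors equal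
  1.\<close>

lemma gE_posdef_pos:
  fixes Y :: "real^'n^'n"
  assumes m: "1 \<le> m" "m \<le> CARD('n)" and Y: "posdef Y" and b: "b > 0"
  shows "gE m b Y > 0"
proof -
  let ?f = "\<lambda>\<tau>::real. gE m ((1 - \<tau>) + \<tau> * b) ((1 - \<tau>) *\<^sub>R mat 1 + \<tau> *\<^sub>R Y)"
  have nz: "?f \<tau> \<noteq> 0" if "\<tau> \<in> {0..1}" for \<tau>
  proof (rule gE_posdef_nz[OF m])
    show "posdef ((1 - \<tau>) *\<^sub>R mat 1 + \<tau> *\<^sub>R Y)"
    proof (cases "\<tau> = 1")
      case False
      with that show ?thesis
        by (intro posdef_add_psd posdef_scale posdef_mat1 psd_scale posdef_imp_psd Y) auto
    qed (use Y in simp)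
    show "1 - \<tau> + \<tau> * b > 0" using that b
      by (cases "\<tau> = 1") (auto intro: add_pos_nonneg)
  qed
  have "gT p (mat 1 :: real^'n^'n) = real (card {I::'n set. card I = p})" for p
    by (simp add: gT_def gminor_mat1)
  moreover have "\<exists>I::'n set. card I = m"
    using obtain_subset_with_card_n[OF m(2)] by blast
  then have "card {I::'n set. card I = m} > 0"
    by (subst card_gt_0_iff) auto
  ultimately have f0: "?f 0 > 0" by (simp add: gE_def)
  have cont: "continuous_on {0..1} ?f" by (intro continuous_intros)
  have "?f 1 > 0"
  proof (rule ccontr)
    assume "\<not> ?f 1 > 0"
    then have "\<exists>\<tau>\<ge>0. \<tau> \<le> 1 \<and> ?f \<tau> = 0"
      using f0 cont by (intro IVT2') auto
    then show False using nz by auto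
  qed
  then show ?thesis by simp
qed

text \<open>For Im z > 0 the pair has imaginary part Im z (b, Y), which is positive definite, so
  \<open>gE_stable\<close> excludes a zero. The coefficients are real, so conjugation excludes the
  lower half-plane too.\<close>

lemma pencil_real_rooted:
  fixes S Y :: "real^'n^'n"
  assumes m: "1 \<le> m" "m \<le> CARD('n)" and S: "transpose S = S" and Y: "posdef Y" and b: "b > 0"
    and z: "poly (map_poly complex_of_real (pencil m b Y a S)) z = 0"
  shows "Im z = 0"
proof -
  have *: "Im z \<le> 0" if z: "poly (map_poly complex_of_real (pencil m b Y a S)) z = 0" for z
  proof (rule ccontr)
    assume "\<not> Im z \<le> 0"
    then have iz: "Im z > 0" by simp
    have "gE m (Complex (a + Re z * b) (Im z * b))
        (\<chi> i j. Complex ((S + Re z *\<^sub>R Y) $ i $ j) ((Im z *\<^sub>R Y) $ i $ j)) \<noteq> 0"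
      using iz b Y S
      by (intro gE_stable[OF m] posdef_scale) (auto simp: posdef_def transpose_add transpose_scaleR)
    moreover have "Complex (a + Re z * b) (Im z * b) = of_real a + z * of_real b"
      by (simp add: complex_eq_iff)
    moreover have "(\<chi> i j. Complex ((S + Re z *\<^sub>R Y) $ i $ j) ((Im z *\<^sub>R Y) $ i $ j)) =
       (\<chi> i j. of_real (S $ i $ j) + z * of_real (Y $ i $ j))"
      by (simp add: vec_eq_iff complex_eq_iff)
    ultimately show False using z by (simp add: poly_pencil_complex)
  qed
  have "map_poly cnj (map_poly complex_of_real (pencil m b Y a S)) = map_poly complex_of_real (pencil m b Y a S)"
    by (rule poly_eqI) (simp add: coeff_map_poly)
  then have "poly (map_poly complex_of_real (pencil m b Y a S)) (cnj z) = 0"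
    using z by (metis poly_cnj complex_cnj_zero)
  from *[OF this] *[OF z] show ?thesis by simp
qed

text \<open>The direction \<open>(b, Y)\<close> is kept as a parameter: the cone does not depend on it when it is
  positive definite, and this independence is what yields monotonicity.\<close>

definition dcone :: "nat \<Rightarrow> real \<Rightarrow> real^'n^'n \<Rightarrow> real \<Rightarrow> real^'n^'n \<Rightarrow> bool" where
  "dcone m b Y a S \<longleftrightarrow> transpose S = S \<and> (\<forall>s\<ge>0. gE m (a + s * b) (S + s *\<^sub>R Y) > 0)"

lemma dcone_coeff_pos:
  fixes S Y :: "real^'n^'n"
  assumes m: "1 \<le> m" "m \<le> CARD('n)" and Y: "posdef Y" and b: "b > 0" and "dcone m b Y a S" "k \<le> m"
  shows "coeff (pencil m b Y a S) k > 0"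
proof (rule real_rooted_pos_coeffs)
  \<comment> \<open>The leading coefficient is \<open>gE m b Y\<close>, so the degree reaches
    \<open>m\<close> and all indices up to \<open>m\<close> are covered.\<close>
  have "coeff (pencil m b Y a S) m \<noteq> 0"
    using pencil_coeff(2)[OF m(1), of b Y a S] gE_posdef_pos[OF m Y b] by simp
  then show "k \<le> degree (pencil m b Y a S)" using assms(6) le_degree by (meson order.trans)
qed (use assms pencil_real_rooted[OF m _ Y b] in \<open>auto simp: dcone_def poly_pencil\<close>)

lemma dcone_coeff_nonneg:
  fixes S Y :: "real^'n^'n"
  assumes m: "1 \<le> m" and S: "transpose S = S" and E: "gE m a S > 0"
    and c: "\<And>k. k \<le> m \<Longrightarrow> coeff (pencil m b Y a S) k \<ge> 0"
  shows "dcone m b Y a S"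
  unfolding dcone_def
proof (intro conjI allI impI S)
  fix s :: real assume s: "s \<ge> 0"
  let ?p = "pencil m b Y a S"
  have "poly ?p s = (\<Sum>k\<le>m. coeff ?p k * s ^ k)"
    by (subst poly_as_sum_of_monoms'[OF pencil_coeff(1)[OF m], symmetric])
       (simp add: poly_sum poly_monom)
  also have "\<dots> \<ge> (\<Sum>k\<in>{0}. coeff ?p k * s ^ k)"
    using s c by (intro sum_mono2) auto
  finally have "coeff ?p 0 \<le> poly ?p s" by simp
  moreover have "coeff ?p 0 = gE m a S"
    using poly_pencil[of m b Y a S 0] by (simp add: poly_0_coeff_0)
  ultimately show "gE m (a + s * b) (S + s *\<^sub>R Y) > 0" using E by (simp add: poly_pencil)
qed

text \<open>A real-rooted polynomial is positive on \<open>[0, \<infinity>)\<close> iff its coefficients are positive, and also iff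
  its constant term is positive and the others are nonnegative: hence the cone is both open and
  closed in \<open>{gE m > 0}\<close>.\<close>

lemma dcone_connected:
  fixes \<sigma> :: "'x::topological_space \<Rightarrow> real^'n^'n"
  assumes m: "1 \<le> m" "m \<le> CARD('n)" and Y: "posdef Y" and b: "b > 0"
    and X: "connected X" and cont: "continuous_on X \<alpha>" "continuous_on X \<sigma>"
    and sym: "\<And>x. x \<in> X \<Longrightarrow> transpose (\<sigma> x) = \<sigma> x"
    and E: "\<And>x. x \<in> X \<Longrightarrow> gE m (\<alpha> x) (\<sigma> x) > 0"
    and x0: "x0 \<in> X" "dcone m b Y (\<alpha> x0) (\<sigma> x0)" and x: "x \<in> X"
  shows "dcone m b Y (\<alpha> x) (\<sigma> x)"
proof -
  let ?c = "\<lambda>k x. coeff (pencil m b Y (\<alpha> x) (\<sigma> x)) k"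
  let ?D = "{x \<in> X. dcone m b Y (\<alpha> x) (\<sigma> x)}"
  have cc: "continuous_on X (?c k)" for k by (intro continuous_pencil_coeff cont)
  have nonneg: "dcone m b Y (\<alpha> x) (\<sigma> x)" if "x \<in> X" "\<And>k. k \<le> m \<Longrightarrow> ?c k x \<ge> 0" for x
    using that dcone_coeff_nonneg[OF m(1) sym E] by blast
  have pos: "?c k x > 0" if "dcone m b Y (\<alpha> x) (\<sigma> x)" "k \<le> m" for x k
    using that dcone_coeff_pos[OF m Y b] by blast
  have eq1: "?D = X \<inter> (\<Inter>k\<in>{..m}. {x \<in> X. ?c k x \<in> {0<..}})" (is "_ = ?R")
  proof
    show "?D \<subseteq> ?R" using pos by auto
    show "?R \<subseteq> ?D"
    proof
      fix x assume x: "x \<in> ?R"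
      then have "dcone m b Y (\<alpha> x) (\<sigma> x)" by (intro nonneg less_imp_le) auto
      then show "x \<in> ?D" using x by simp
    qed
  qed
  have eq2: "?D = X \<inter> (\<Inter>k\<in>{..m}. {x \<in> X. ?c k x \<in> {0..}})" (is "_ = ?R")
  proof
    show "?D \<subseteq> ?R" using less_imp_le[OF pos] by auto
    show "?R \<subseteq> ?D"
    proof
      fix x assume x: "x \<in> ?R"
      then have "dcone m b Y (\<alpha> x) (\<sigma> x)" by (intro nonneg) auto
      then show "x \<in> ?D" using x by simp
    qed
  qed
  have "openin (top_of_set X) {x \<in> X. ?c k x \<in> {0<..}}" for k
    using continuous_openin_preimage_gen[OF cc open_greaterThan] by (simp add: vimage_def Int_def)
  then have "openin (top_of_set X) ((\<Inter>k\<in>{..m}. {x \<in> X. ?c k x \<in> {0<..}}) \<inter> topspace (top_of_set X))"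
    by (intro openin_INT) auto
  then have "openin (top_of_set X) ?D"
    unfolding eq1 by (simp add: Int_commute)
  moreover have "closedin (top_of_set X) {x \<in> X. ?c k x \<in> {0..}}" for k
    using continuous_closedin_preimage[OF cc closed_atLeast] by (simp add: vimage_def Int_def)
  then have "closedin (top_of_set X) ?D"
    unfolding eq2 by (intro closedin_Int closedin_INT) auto
  ultimately have "?D = {} \<or> ?D = X" using X by (meson connected_clopen)
  then show ?thesis using x0 x by auto
qed

section \<open>The cone of the direction (1, I) and monotonicity on it\<close>

abbreviation garding_cone :: "nat \<Rightarrow> real \<Rightarrow> real^'n^'n \<Rightarrow> bool" where
  "garding_cone m \<equiv> dcone m 1 (mat 1)"

lemma cone_sym: "garding_cone m a S \<Longrightarrow> transpose S = S"
  by (simp add: dcone_def)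

lemma cone_gE_pos: "garding_cone m a S \<Longrightarrow> gE m a S > 0"
  unfolding dcone_def by (metis add.right_neutral mult_zero_left order_refl scaleR_zero_left)

lemma cone_shift:
  assumes "garding_cone m a S" "r \<ge> 0"
  shows "garding_cone m (a + r) (S + r *\<^sub>R mat 1)"
  unfolding dcone_def
proof (intro conjI allI impI)
  show "transpose (S + r *\<^sub>R mat 1) = S + r *\<^sub>R mat 1"
    using cone_sym[OF assms(1)] by (simp add: transpose_add transpose_scaleR transpose_mat)
  fix s :: real assume "s \<ge> 0"
  then have "gE m (a + (r + s) * 1) (S + (r + s) *\<^sub>R mat 1) > 0"
    using assms unfolding dcone_def by (metis add_nonneg_nonneg)
  then show "gE m (a + r + s * 1) (S + r *\<^sub>R mat 1 + s *\<^sub>R mat 1) > 0"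
    by (simp add: algebra_simps)
qed

lemma posdef_shift:
  fixes S :: "real^'n^'n"
  assumes S: "transpose S = S"
  shows "\<exists>R\<ge>0. \<forall>r\<ge>R. posdef (S + r *\<^sub>R mat 1)"
proof -
  obtain B where B: "\<And>x. norm (S *v x) \<le> norm x * B"
    using bounded_linear.bounded[OF matrix_vector_mul_bounded_linear[of S]] by blast
  have "posdef (S + r *\<^sub>R mat 1)" if r: "r \<ge> max 0 B + 1" for r
    unfolding posdef_def
  proof (intro conjI allI impI)
    show "transpose (S + r *\<^sub>R mat 1) = S + r *\<^sub>R mat 1"
      using S by (simp add: transpose_add transpose_scaleR transpose_mat)
    fix x :: "real^'n" assume x: "x \<noteq> 0"
    have "\<bar>x \<bullet> (S *v x)\<bar> \<le> norm x * norm (S *v x)" by (rule Cauchy_Schwarz_ineq2)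
    also have "\<dots> \<le> norm x * (norm x * B)" by (intro mult_left_mono B) simp
    finally have "x \<bullet> (S *v x) \<ge> - B * (x \<bullet> x)"
      by (simp add: dot_square_norm power2_eq_square algebra_simps)
    moreover have "(r - B) * (x \<bullet> x) > 0" using r x by simp
    ultimately show "x \<bullet> ((S + r *\<^sub>R mat 1) *v x) > 0"
      by (simp add: matrix_vector_mult_add_rdistrib scaleR_matrix_vector_assoc[symmetric]
          inner_add_right algebra_simps)
  qed
  then show ?thesis by (intro exI[of _ "max 0 B + 1"]) auto
qed

lemma posdef_imp_dcone:
  fixes S Y :: "real^'n^'n"
  assumes m: "1 \<le> m" "m \<le> CARD('n)" and "posdef S" "a > 0" "psd Y" "b \<ge> 0"
  shows "dcone m b Y a S"
  unfolding dcone_def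
  using assms by (auto intro!: gE_posdef_pos[OF m] posdef_add_psd psd_scale add_pos_nonneg simp: posdef_def)

text \<open>Along r -> (a + r, S + r I) the operator stays positive by definition of the cone. For
  large r the pair is positive definite, hence in the cone of every such direction, and
  connectedness brings this back to r = 0.\<close>

lemma cone_imp_dcone:
  fixes S Y :: "real^'n^'n"
  assumes m: "1 \<le> m" "m \<le> CARD('n)" and c: "garding_cone m a S" and Y: "posdef Y" and b: "b > 0"
  shows "dcone m b Y a S"
proof -
  obtain R where R: "R \<ge> 0" "\<And>r. r \<ge> R \<Longrightarrow> posdef (S + r *\<^sub>R mat 1)"
    using posdef_shift[OF cone_sym[OF c]] by blast
  define r1 where "r1 = max R (\<bar>a\<bar> + 1)"
  have "dcone m b Y (a + 0) (S + 0 *\<^sub>R mat 1)"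
  proof (rule dcone_connected[OF m Y b, of "{0..}" "\<lambda>r. a + r" "\<lambda>r. S + r *\<^sub>R mat 1" r1 0])
    show "dcone m b Y (a + r1) (S + r1 *\<^sub>R mat 1)"
      using R(2)[of r1] Y b by (intro posdef_imp_dcone[OF m] posdef_imp_psd) (auto simp: r1_def)
    show "transpose (S + r *\<^sub>R mat 1) = S + r *\<^sub>R mat 1" if "r \<in> {0..}" for r
      using cone_sym[OF cone_shift[OF c, of r]] that by simp
    show "gE m (a + r) (S + r *\<^sub>R mat 1) > 0" if "r \<in> {0..}" for r
      using cone_gE_pos[OF cone_shift[OF c, of r]] that by simp
  qed (use R in \<open>auto intro!: continuous_intros simp: r1_def\<close>)
  then show ?thesis by simp
qed

text \<open>Going from s = 0 to s = 1 along the pencil adds its higher coefficients, which are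
  positive.\<close>

lemma dcone_gE_mono:
  fixes S Y :: "real^'n^'n"
  assumes m: "1 \<le> m" "m \<le> CARD('n)" and Y: "posdef Y" and b: "b > 0" and c: "dcone m b Y a S"
  shows "gE m a S \<le> gE m (a + b) (S + Y)"
proof -
  let ?p = "pencil m b Y a S"
  have "poly ?p 1 = (\<Sum>k\<le>m. coeff ?p k)"
    by (subst poly_as_sum_of_monoms'[OF pencil_coeff(1)[OF m(1)], symmetric])
       (simp add: poly_sum poly_monom)
  also have "\<dots> \<ge> (\<Sum>k\<in>{0}. coeff ?p k)"
    using dcone_coeff_pos[OF m Y b c] by (intro sum_mono2) (auto intro: less_imp_le)
  finally have "poly ?p 0 \<le> poly ?p 1" by (simp add: poly_0_coeff_0)
  then show ?thesis by (simp add: poly_pencil)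
qed

text \<open>A semidefinite direction is the limit of the positive definite directions (b + d, Y + d
  I) as d decreases to 0.\<close>

lemma cone_gE_mono:
  fixes S Y :: "real^'n^'n"
  assumes m: "1 \<le> m" "m \<le> CARD('n)" and c: "garding_cone m a S" and Y: "psd Y" and b: "b \<ge> 0"
  shows "gE m a S \<le> gE m (a + b) (S + Y)"
proof -
  let ?f = "\<lambda>d::real. gE m (a + (b + d)) (S + (d *\<^sub>R mat 1 + Y))"
  have "(?f \<longlongrightarrow> ?f 0) (at_right 0)"
  proof -
    have "continuous_on UNIV ?f" by (intro continuous_intros)
    then have "isCont ?f 0" using continuous_on_eq_continuous_at[OF open_UNIV] by blast
    then have "(?f \<longlongrightarrow> ?f 0) (at 0)" by (rule isContD)
    then show ?thesis by (rule tendsto_within_subset) simp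
  qed
  moreover have "\<forall>\<^sub>F d in at_right 0. gE m a S \<le> ?f d"
  proof (rule eventually_at_rightI[of 0 1])
    fix d :: real assume "d \<in> {0<..<1}"
    then have d: "d > 0" by simp
    have "posdef (d *\<^sub>R mat 1 + Y)" using d Y by (intro posdef_add_psd posdef_scale posdef_mat1)
    then show "gE m a S \<le> ?f d"
      using cone_imp_dcone[OF m c] dcone_gE_mono[OF m] d b by (simp add: add_nonneg_pos)
  qed simp
  ultimately have "gE m a S \<le> ?f 0"
    by (intro tendsto_lowerbound) auto
  then show ?thesis by simp
qed

text \<open>Both pairs are shifted along (1, I) by the same r, and the values are compared at each
  r.\<close>

lemma cone_mono:
  fixes S Y :: "real^'n^'n"
  assumes m: "1 \<le> m" "m \<le> CARD('n)" and c: "garding_cone m a S" and Y: "psd Y" and b: "b \<ge> 0"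
  shows "garding_cone m (a + b) (S + Y)"
  unfolding dcone_def
proof (intro conjI allI impI)
  show "transpose (S + Y) = S + Y" using cone_sym[OF c] Y by (simp add: psd_def transpose_add)
  fix r :: real assume "r \<ge> 0"
  note cs = cone_shift[OF c this]
  have "0 < gE m (a + r) (S + r *\<^sub>R mat 1)" by (rule cone_gE_pos[OF cs])
  also have "\<dots> \<le> gE m (a + r + b) (S + r *\<^sub>R mat 1 + Y)" by (rule cone_gE_mono[OF m cs Y b])
  finally show "gE m (a + b + r * 1) (S + Y + r *\<^sub>R mat 1) > 0" by (simp add: algebra_simps)
qed

section \<open>Shifts by multiples of the identity\<close>

text \<open>Taylor expansion of \<open>p\<close> at \<open>r\<close>.\<close>

lemma coeff_pcompose_shift:
  fixes p :: "real poly"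
  shows "coeff (pcompose p [:r, 1:]) j = poly ((pderiv ^^ j) p) r / fact j"
proof -
  have "(pderiv ^^ j) (pcompose p [:r, 1:]) = pcompose ((pderiv ^^ j) p) [:r, 1:]"
    by (induction j) (simp_all add: pderiv_pcompose pderiv_pCons)
  then have "coeff ((pderiv ^^ j) (pcompose p [:r, 1:])) 0 = poly ((pderiv ^^ j) p) r" by simp
  then show ?thesis by (simp add: coeff_higher_pderiv pochhammer_fact[symmetric] field_simps)
qed

text \<open>For \<open>k \<le> CARD('n)\<close> this is r -> T_k(S + r I): the coefficient of
  x^(n-k) in det(S + (r + x) I) is, by Taylor's formula, the derivative of that order divided by its
  factorial.\<close>

definition shift_poly :: "nat \<Rightarrow> real^'n^'n \<Rightarrow> real poly" where
  "shift_poly k S = smult (1 / fact (CARD('n) - k)) ((pderiv ^^ (CARD('n) - k)) (cpoly S))"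

lemma poly_shift_poly:
  fixes S :: "real^'n^'n"
  assumes "k \<le> CARD('n)"
  shows "poly (shift_poly k S) r = gT k (S + r *\<^sub>R mat 1)"
proof -
  have "poly (cpoly (S + r *\<^sub>R mat 1)) = poly (pcompose (cpoly S) [:r, 1:])"
  proof
    fix x
    have "(\<chi> i j. (S + r *\<^sub>R mat 1) $ i $ j + (if i = j then x else 0)) =
          (\<chi> i j. S $ i $ j + (if i = j then r + x else 0))"
      by (simp add: vec_eq_iff mat_def)
    then show "poly (cpoly (S + r *\<^sub>R mat 1)) x = poly (pcompose (cpoly S) [:r, 1:]) x"
      by (simp add: poly_cpoly poly_pcompose)
  qed
  then have "cpoly (S + r *\<^sub>R mat 1) = pcompose (cpoly S) [:r, 1:]"
    by (simp add: poly_eq_poly_eq_iff)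
  then show ?thesis
    using coeff_cpoly[OF assms, of "S + r *\<^sub>R mat 1"]
    by (simp add: coeff_pcompose_shift shift_poly_def)
qed

text \<open>One more derivative leads from index k + 1 to k; the factor n - k is the quotient of the
  two normalising factorials.\<close>

lemma pderiv_shift_poly:
  fixes S :: "real^'n^'n"
  assumes "Suc k \<le> CARD('n)"
  shows "pderiv (shift_poly (Suc k) S) = smult (real (CARD('n) - k)) (shift_poly k S)"
proof -
  obtain j where j: "CARD('n) - k = Suc j" "CARD('n) - Suc k = j"
    using assms by (metis Suc_diff_le diff_Suc_Suc)
  show ?thesis by (simp add: shift_poly_def j pderiv_smult fact_Suc field_simps del: of_nat_Suc)
qed

lemma degree_shift_poly:
  fixes S :: "real^'n^'n"
  assumes "k \<le> CARD('n)"
  shows "degree (shift_poly k S) \<le> k"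
  using assms by (simp add: shift_poly_def degree_higher_pderiv degree_cpoly)

text \<open>Raising \<open>a\<close> by \<open>\<tau> \<ge> 0\<close> stays in the cone and adds
  \<open>\<tau>\<close> times this polynomial to the pencil. Positivity of the coefficients C +
  \<open>\<tau>\<close> R for all such \<open>\<tau>\<close> forces R >= 0.\<close>

lemma cone_shift_poly_nonneg:
  fixes S :: "real^'n^'n"
  assumes m: "1 \<le> m" "m \<le> CARD('n)" and c: "garding_cone m a S"
  shows "coeff (shift_poly (m - 1) S) k \<ge> 0"
proof (cases "k \<le> m")
  case False
  moreover have "degree (shift_poly (m - 1) S) \<le> m - 1"
    using m by (intro degree_shift_poly) simp
  ultimately have "coeff (shift_poly (m - 1) S) k = 0"
    by (intro coeff_eq_0) linarith
  then show ?thesis by simp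
next
  case k: True
  let ?R = "shift_poly (m - 1) S"
  let ?C = "coeff (pencil m 1 (mat 1) a S) k"
  have pos: "?C + \<tau> * coeff ?R k > 0" if "\<tau> \<ge> 0" for \<tau>
  proof -
    have "garding_cone m (a + \<tau>) (S + 0)"
      by (rule cone_mono[OF m c _ that]) (simp add: psd_def transpose_def vec_eq_iff)
    then have "coeff (pencil m 1 (mat 1) (a + \<tau>) S) k > 0"
      using dcone_coeff_pos[OF m posdef_mat1 _ _ k] by simp
    moreover have "poly (pencil m 1 (mat 1) (a + \<tau>) S) = poly (pencil m 1 (mat 1) a S + smult \<tau> ?R)"
      using m by (simp add: fun_eq_iff poly_pencil poly_shift_poly gE_def algebra_simps)
    ultimately show ?thesis by (simp add: poly_eq_poly_eq_iff)
  qed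
  show ?thesis
  proof (rule ccontr)
    assume "\<not> coeff ?R k \<ge> 0"
    \<comment> \<open>If R < 0, then C + \<open>\<tau>\<close> R vanishes at \<open>\<tau>\<close> =
      C / (-R), an allowed value because \<open>\<tau>\<close> = 0 gives C > 0.\<close>
    then show False using pos[of "?C / - coeff ?R k"] pos[of 0]
      by (simp add: divide_le_0_iff not_le)
  qed
qed

lemma poly_nonneg_coeffs_mono:
  fixes p :: "real poly"
  assumes "\<And>k. coeff p k \<ge> 0" "0 \<le> s" "s \<le> t"
  shows "poly p s \<le> poly p t"
  unfolding poly_altdef using assms by (intro sum_mono mult_left_mono power_mono) auto

lemma cone_gT_mono:
  fixes S :: "real^'n^'n"
  assumes m: "1 \<le> m" "m \<le> CARD('n)" and c: "garding_cone m a S" and s: "s \<ge> 0"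
  shows "gT (m - 1) S \<ge> 0" "gT (m - 1) S \<le> gT (m - 1) (S + s *\<^sub>R mat 1)"
proof -
  have p: "poly (shift_poly (m - 1) S) s = gT (m - 1) (S + s *\<^sub>R mat 1)" for s
    using m by (intro poly_shift_poly) simp
  show "gT (m - 1) S \<ge> 0"
    using p[of 0] cone_shift_poly_nonneg[OF m c, of 0] by (simp add: poly_0_coeff_0)
  show "gT (m - 1) S \<le> gT (m - 1) (S + s *\<^sub>R mat 1)"
    using poly_nonneg_coeffs_mono[OF cone_shift_poly_nonneg[OF m c], of 0 s] s p[of 0] p[of s] by simp
qed

text \<open>Let q(r) = T_m(S + r I). Its degree is at most m and its nonconstant coefficients are
  nonnegative, so s q'(s), the sum of i q_i s^i, is at most m (q(s) - q(0)); moreover q' = N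
  T_{m-1}(S + r I) with N = n - m + 1 >= 1. Convexity of q alone would give T_{m-1}(S), whereas the
  barriers need the shifted matrix.\<close>

lemma cone_gT_increment:
  fixes S :: "real^'n^'n"
  assumes m: "1 \<le> m" "m \<le> CARD('n)" and c: "garding_cone m a S" and s: "s \<ge> 0"
  shows "gT m S + s / m * gT (m - 1) (S + s *\<^sub>R mat 1) \<le> gT m (S + s *\<^sub>R mat 1)"
proof -
  obtain k where k: "m = Suc k" using m by (cases m) auto
  let ?q = "shift_poly m S" and ?R = "shift_poly k S"
  define N where "N = real (CARD('n) - k)"
  have N: "N \<ge> 1" using m k by (simp add: N_def)
  have dq: "pderiv ?q = smult N ?R" using pderiv_shift_poly[of k S] m k by (simp add: N_def)
  have Rnn: "coeff ?R i \<ge> 0" for i using cone_shift_poly_nonneg[OF m c, of i] k by simp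
  have qnn: "coeff ?q i \<ge> 0" if i: "i \<ge> 1" for i
  proof -
    obtain l where l: "i = Suc l" using i by (cases i) auto
    have "of_nat (Suc l) * coeff ?q (Suc l) = N * coeff ?R l"
      using arg_cong[OF dq, of "\<lambda>p. coeff p l"] by (simp add: coeff_pderiv)
    moreover have "N * coeff ?R l \<ge> 0" using N Rnn by simp
    ultimately show ?thesis unfolding l by (metis of_nat_0_less_iff zero_less_Suc zero_le_mult_iff not_less)
  qed
  have q: "?q = (\<Sum>i\<le>m. monom (coeff ?q i) i)"
    using degree_shift_poly[OF m(2), of S] by (simp add: poly_as_sum_of_monoms')
  have qs: "poly ?q x = (\<Sum>i\<le>m. coeff ?q i * x ^ i)" for x
    by (subst q) (simp add: poly_sum poly_monom)
  have dqs: "s * poly (pderiv ?q) s = (\<Sum>i\<le>m. real i * coeff ?q i * s ^ i)"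
  proof -
    have "s * poly (pderiv ?q) s = (\<Sum>i\<le>m. s * (real i * coeff ?q i * s ^ (i - 1)))"
      by (subst q) (simp add: higher_pderiv_sum[of 1, simplified] pderiv_monom poly_sum poly_monom sum_distrib_left)
    also have "\<dots> = (\<Sum>i\<le>m. real i * coeff ?q i * s ^ i)"
    proof (intro sum.cong refl)
      fix i show "s * (real i * coeff ?q i * s ^ (i - 1)) = real i * coeff ?q i * s ^ i"
        by (cases i) simp_all
    qed
    finally show ?thesis .
  qed
  have "s * poly ?R s \<le> s * (N * poly ?R s)"
  proof -
    have "0 \<le> s * poly ?R s"
      using poly_nonneg_coeffs_mono[OF Rnn, of 0 s] s Rnn[of 0] by (simp add: poly_0_coeff_0)
    from mult_right_mono[OF N this] show ?thesis by (simp add: algebra_simps)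
  qed
  also have "\<dots> = s * poly (pderiv ?q) s" by (simp add: dq)
  \<comment> \<open>The constant coefficient T_m(S) may be negative, so it is removed before the
    factor i is replaced by m.\<close>
  also have "\<dots> \<le> (\<Sum>i\<le>m. real m * (coeff ?q i * s ^ i - (if i = 0 then coeff ?q 0 else 0)))"
    unfolding dqs
  proof (intro sum_mono)
    fix i assume "i \<in> {..m}"
    then show "real i * coeff ?q i * s ^ i \<le> real m * (coeff ?q i * s ^ i - (if i = 0 then coeff ?q 0 else 0))"
      using qnn[of i] s by (cases "i = 0") (auto simp: mult.assoc intro!: mult_right_mono)
  qed
  also have "\<dots> = real m * (poly ?q s - poly ?q 0)"
    by (simp add: qs[of s] poly_0_coeff_0 sum_distrib_left[symmetric] sum_subtractf)
  finally have "s / m * poly ?R s \<le> poly ?q s - poly ?q 0"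
    using m by (simp add: field_simps)
  then show ?thesis using m k by (simp add: poly_shift_poly)
qed

text \<open>By induction on k: the derivative of r -> T_{k+1}(S + r I) is a positive multiple of
  T_k(S + r I), so the value cannot fall below the positive one at r = 0.\<close>

lemma gT_shift_pos:
  fixes S :: "real^'n^'n"
  assumes "\<And>p. p \<in> {1..k} \<Longrightarrow> gT p S > 0" "k \<le> CARD('n)" "r \<ge> 0"
  shows "gT k (S + r *\<^sub>R mat 1) > 0"
  using assms
proof (induction k arbitrary: r)
  case (Suc k)
  let ?q = "shift_poly (Suc k) S"
  have "\<exists>y. (poly ?q has_real_derivative y) (at x) \<and> y \<ge> 0" if "0 \<le> x" for x
  proof -
    have "poly (pderiv ?q) x = real (CARD('n) - k) * gT k (S + x *\<^sub>R mat 1)"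
      using Suc.prems by (simp add: pderiv_shift_poly poly_shift_poly)
    moreover have "gT k (S + x *\<^sub>R mat 1) > 0" using Suc that by auto
    ultimately show ?thesis using poly_DERIV[of ?q x] by auto
  qed
  then have "poly ?q 0 \<le> poly ?q r"
    using Suc.prems(3) by (intro DERIV_nonneg_imp_nondecreasing[of 0 r "poly ?q"]) auto
  moreover have "gT (Suc k) S > 0" using Suc.prems(1) by simp
  ultimately show ?case using Suc.prems(2) by (simp add: poly_shift_poly)
qed simp

text \<open>For large \<open>a\<close> the pair \<open>(a, S)\<close> is visibly in the cone; lowering \<open>a\<close> keeps \<open>gE m\<close> positive.
  This replaces the use of Newton's inequalities.\<close>

lemma cone_of_positive:
  fixes S :: "real^'n^'n"
  assumes m: "1 \<le> m" "m \<le> CARD('n)" and S: "transpose S = S"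
    and pos: "\<And>p. p \<in> {1..m - 1} \<Longrightarrow> gT p S > 0" and E: "gE m a S > 0"
  shows "garding_cone m a S"
proof -
  let ?P = "\<lambda>r. gT (m - 1) (S + r *\<^sub>R mat 1)" and ?Q = "\<lambda>r. gT m (S + r *\<^sub>R mat 1)"
  have P: "?P r > 0" if "r \<ge> 0" for r using gT_shift_pos[OF pos _ that] m by simp
  obtain R where R: "R \<ge> 0" "\<And>r. r \<ge> R \<Longrightarrow> posdef (S + r *\<^sub>R mat 1)"
    using posdef_shift[OF S] by blast
  have "continuous_on {0..R} (\<lambda>r. ?Q r / ?P r + r)"
    using P by (intro continuous_intros) force+
  then have "\<exists>x\<in>{0..R}. \<forall>r\<in>{0..R}. ?Q x / ?P x + x \<le> ?Q r / ?P r + r"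
    using R(1) by (intro continuous_attains_inf) auto
  then obtain r0 where r0: "\<And>r. r \<in> {0..R} \<Longrightarrow> ?Q r0 / ?P r0 + r0 \<le> ?Q r / ?P r + r" by blast
  \<comment> \<open>On [0, R] the operator is P(r) (a1 + r + Q(r)/P(r)), and the minimum at
    \<open>r0\<close> makes the bracket at least 1. Beyond R the pair is positive definite, as a1 >=
    1.\<close>
  define a1 where "a1 = max (max a 1) (1 - (?Q r0 / ?P r0 + r0))"
  have a1: "a \<le> a1" by (simp add: a1_def)
  have c1: "garding_cone m a1 S"
    unfolding dcone_def
  proof (intro conjI allI impI S)
    fix r :: real assume r: "0 \<le> r"
    show "0 < gE m (a1 + r * 1) (S + r *\<^sub>R mat 1)"
    proof (cases "r \<le> R")
      case True
      then have "a1 + r + ?Q r / ?P r > 0" using r0[of r] r by (auto simp: a1_def)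
      then have "(a1 + r + ?Q r / ?P r) * ?P r > 0" using P[OF r] by simp
      then show ?thesis using P[OF r] by (simp add: gE_def algebra_simps)
    next
      case False
      then show ?thesis using R(2)[of r] r by (intro gE_posdef_pos[OF m]) (auto simp: a1_def)
    qed
  qed
  show ?thesis
  proof (rule dcone_connected[OF m posdef_mat1, of 1 "{a..a1}" "\<lambda>x. x" "\<lambda>x. S" a1 a])
    fix x assume "x \<in> {a..a1}"
    then have "(x - a) * gT (m - 1) S \<ge> 0" using P[of 0] by (simp add: less_imp_le)
    then show "gE m x S > 0" using E by (simp add: gE_def algebra_simps)
  qed (use S c1 a1 in auto)
qed

section \<open>Second derivatives and the maximum principle\<close>

lemma DERIV_along_line:
  fixes f :: "real^'n \<Rightarrow> real"
  assumes "(f has_derivative (\<lambda>h. D \<bullet> h)) (at (x + \<tau> *\<^sub>R h))"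
  shows "((\<lambda>\<tau>. f (x + \<tau> *\<^sub>R h)) has_real_derivative D \<bullet> h) (at \<tau>)"
proof -
  have "((\<lambda>\<tau>. f (x + \<tau> *\<^sub>R h)) has_derivative (\<lambda>r. D \<bullet> (r *\<^sub>R h))) (at \<tau>)"
    by (rule has_derivative_compose[of "\<lambda>\<tau>. x + \<tau> *\<^sub>R h" "\<lambda>r. r *\<^sub>R h" \<tau> UNIV f, OF _ assms])
       (auto intro!: derivative_eq_intros)
  then show ?thesis by (simp add: has_field_derivative_def mult_commute_abs)
qed

text \<open>The mean value theorem in direction h, applied to the increment of f in direction k,
  leaves a difference of gradients near x, which the first-order expansion of \<open>Df\<close> at x
  evaluates.\<close>

lemma second_difference_tendsto:
  fixes f :: "real^'n \<Rightarrow> real"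
  assumes S: "open S" "x \<in> S"
    and f: "\<And>y. y \<in> S \<Longrightarrow> (f has_derivative (\<lambda>h. Df y \<bullet> h)) (at y)"
    and Df: "(Df has_derivative (\<lambda>h. H *v h)) (at x)"
  shows "((\<lambda>\<tau>. (f (x + \<tau> *\<^sub>R h + \<tau> *\<^sub>R k) - f (x + \<tau> *\<^sub>R h) - f (x + \<tau> *\<^sub>R k) + f x) / \<tau>\<^sup>2)
          \<longlongrightarrow> h \<bullet> (H *v k)) (at_right 0)"
proof (rule tendstoI)
  fix e :: real assume e: "e > 0"
  define B where "B = norm h + norm k + 1"
  have B: "B > 0" "norm h + norm k \<le> B" "norm h \<le> B" "norm k \<le> B" by (auto simp: B_def add_nonneg_pos)
  \<comment> \<open>Two remainders of size e' \<open>\<tau>\<close> B are paired with h, of norm at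
    most B; this choice bounds the total by \<open>\<tau>\<close> e / 2.\<close>
  define e' where "e' = e / (4 * B * B)"
  have e': "e' > 0" using e B by (simp add: e'_def)
  obtain d1 where d1: "d1 > 0" "\<And>y. norm (y - x) < d1 \<Longrightarrow> norm (Df y - Df x - H *v (y - x)) \<le> e' * norm (y - x)"
    using Df e' unfolding has_derivative_at_alt by blast
  obtain d2 where d2: "d2 > 0" "ball x d2 \<subseteq> S" using S open_contains_ball by blast
  define d where "d = min d1 d2"
  have d: "d > 0" using d1 d2 by (simp add: d_def)
  have "dist ((f (x + \<tau> *\<^sub>R h + \<tau> *\<^sub>R k) - f (x + \<tau> *\<^sub>R h) - f (x + \<tau> *\<^sub>R k) + f x) / \<tau>\<^sup>2) (h \<bullet> (H *v k)) < e"
    if \<tau>: "\<tau> \<in> {0<..<d / B}" for \<tau>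
  proof -
    have \<tau>0: "\<tau> > 0" and \<tau>B: "\<tau> * B < d" using \<tau> B by (auto simp: field_simps)
    have bd: "norm (\<sigma> *\<^sub>R h + \<rho> *\<^sub>R k) \<le> \<tau> * B" if "0 \<le> \<sigma>" "\<sigma> \<le> \<tau>" "0 \<le> \<rho>" "\<rho> \<le> \<tau>" for \<sigma> \<rho>
    proof -
      have "norm (\<sigma> *\<^sub>R h + \<rho> *\<^sub>R k) \<le> \<sigma> * norm h + \<rho> * norm k"
        using that by (intro order.trans[OF norm_triangle_ineq]) simp
      also have "\<dots> \<le> \<tau> * norm h + \<tau> * norm k" using that by (intro add_mono mult_right_mono) auto
      also have "\<dots> \<le> \<tau> * B" using B(2) \<tau>0 by (simp add: distrib_left[symmetric])
      finally show ?thesis .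
    qed
    have inS: "x + (\<sigma> *\<^sub>R h + \<rho> *\<^sub>R k) \<in> S" if "0 \<le> \<sigma>" "\<sigma> \<le> \<tau>" "0 \<le> \<rho>" "\<rho> \<le> \<tau>" for \<sigma> \<rho>
    proof (rule subsetD[OF d2(2)])
      show "x + (\<sigma> *\<^sub>R h + \<rho> *\<^sub>R k) \<in> ball x d2"
        using bd[OF that] \<tau>B unfolding mem_ball dist_commute[of x] by (simp add: d_def dist_norm)
    qed
    let ?\<psi> = "\<lambda>\<sigma>. f (x + \<tau> *\<^sub>R k + \<sigma> *\<^sub>R h) - f (x + \<sigma> *\<^sub>R h)"
    have "\<exists>\<xi>>0. \<xi> < \<tau> \<and> ?\<psi> \<tau> - ?\<psi> 0 = (\<tau> - 0) * (Df (x + \<tau> *\<^sub>R k + \<xi> *\<^sub>R h) \<bullet> h - Df (x + \<xi> *\<^sub>R h) \<bullet> h)"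
    proof (rule MVT2[OF \<tau>0])
      fix \<sigma> assume "0 \<le> \<sigma>" "\<sigma> \<le> \<tau>"
      then have "x + \<tau> *\<^sub>R k + \<sigma> *\<^sub>R h \<in> S" "x + \<sigma> *\<^sub>R h \<in> S"
        using inS[of \<sigma> \<tau>] inS[of \<sigma> 0] \<tau>0 by (auto simp: algebra_simps)
      then show "(?\<psi> has_real_derivative Df (x + \<tau> *\<^sub>R k + \<sigma> *\<^sub>R h) \<bullet> h - Df (x + \<sigma> *\<^sub>R h) \<bullet> h) (at \<sigma>)"
        by (intro DERIV_diff DERIV_along_line f)
    qed
    then obtain \<xi> where \<xi>: "0 < \<xi>" "\<xi> < \<tau>"
      "?\<psi> \<tau> - ?\<psi> 0 = \<tau> * ((Df (x + \<tau> *\<^sub>R k + \<xi> *\<^sub>R h) - Df (x + \<xi> *\<^sub>R h)) \<bullet> h)"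
      by (auto simp: inner_diff_left)
    define r where "r = (\<lambda>y. Df y - Df x - H *v (y - x))"
    have rb: "norm (r (x + (\<xi> *\<^sub>R h + \<rho> *\<^sub>R k))) \<le> e' * (\<tau> * B)" if "0 \<le> \<rho>" "\<rho> \<le> \<tau>" for \<rho>
    proof -
      have b: "norm (\<xi> *\<^sub>R h + \<rho> *\<^sub>R k) \<le> \<tau> * B" using \<xi> that by (intro bd) auto
      then have "norm (r (x + (\<xi> *\<^sub>R h + \<rho> *\<^sub>R k))) \<le> e' * norm (\<xi> *\<^sub>R h + \<rho> *\<^sub>R k)"
        using d1(2)[of "x + (\<xi> *\<^sub>R h + \<rho> *\<^sub>R k)"] \<tau>B by (simp add: r_def d_def)
      also have "\<dots> \<le> e' * (\<tau> * B)" using b e' by (intro mult_left_mono) auto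
      finally show ?thesis .
    qed
    have r1: "norm (r (x + \<tau> *\<^sub>R k + \<xi> *\<^sub>R h)) \<le> e' * (\<tau> * B)" "norm (r (x + \<xi> *\<^sub>R h)) \<le> e' * (\<tau> * B)"
      using rb[of \<tau>] rb[of 0] \<tau>0 by (auto simp: algebra_simps)
    have eqD: "Df (x + \<tau> *\<^sub>R k + \<xi> *\<^sub>R h) - Df (x + \<xi> *\<^sub>R h) =
        \<tau> *\<^sub>R (H *v k) + (r (x + \<tau> *\<^sub>R k + \<xi> *\<^sub>R h) - r (x + \<xi> *\<^sub>R h))"
      by (simp add: r_def matrix_vector_right_distrib matrix_vector_mult_scaleR algebra_simps)
    have eq: "?\<psi> \<tau> - ?\<psi> 0 - \<tau>\<^sup>2 * (h \<bullet> (H *v k)) =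
        \<tau> * ((r (x + \<tau> *\<^sub>R k + \<xi> *\<^sub>R h) - r (x + \<xi> *\<^sub>R h)) \<bullet> h)"
      unfolding \<xi>(3) eqD by (simp add: inner_add_left inner_commute power2_eq_square algebra_simps)
    have "\<bar>(r (x + \<tau> *\<^sub>R k + \<xi> *\<^sub>R h) - r (x + \<xi> *\<^sub>R h)) \<bullet> h\<bar>
        \<le> norm (r (x + \<tau> *\<^sub>R k + \<xi> *\<^sub>R h) - r (x + \<xi> *\<^sub>R h)) * norm h"
      by (rule Cauchy_Schwarz_ineq2)
    also have "\<dots> \<le> (2 * e' * (\<tau> * B)) * B"
      using r1 norm_triangle_ineq4[of "r (x + \<tau> *\<^sub>R k + \<xi> *\<^sub>R h)" "r (x + \<xi> *\<^sub>R h)"] B e' \<tau>0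
      by (intro mult_mono) auto
    also have "\<dots> = \<tau> * e / 2" using B by (simp add: e'_def)
    finally have "\<bar>?\<psi> \<tau> - ?\<psi> 0 - \<tau>\<^sup>2 * (h \<bullet> (H *v k))\<bar> \<le> \<tau> * (\<tau> * e / 2)"
      unfolding eq using \<tau>0 by (simp add: abs_mult)
    also have "\<dots> < \<tau>\<^sup>2 * e" using \<tau>0 e by (simp add: power2_eq_square)
    finally have "\<bar>(?\<psi> \<tau> - ?\<psi> 0) / \<tau>\<^sup>2 - h \<bullet> (H *v k)\<bar> < e"
    proof -
      assume a: "\<bar>?\<psi> \<tau> - ?\<psi> 0 - \<tau>\<^sup>2 * (h \<bullet> (H *v k))\<bar> < \<tau>\<^sup>2 * e"
      have "(?\<psi> \<tau> - ?\<psi> 0) / \<tau>\<^sup>2 - h \<bullet> (H *v k) = (?\<psi> \<tau> - ?\<psi> 0 - \<tau>\<^sup>2 * (h \<bullet> (H *v k))) / \<tau>\<^sup>2"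
        using \<tau>0 by (simp add: diff_divide_distrib)
      then show ?thesis using a \<tau>0 by (simp add: abs_divide pos_divide_less_eq mult.commute)
    qed
    then show ?thesis by (simp add: dist_real_def algebra_simps)
  qed
  then show "\<forall>\<^sub>F \<tau> in at_right 0. dist ((f (x + \<tau> *\<^sub>R h + \<tau> *\<^sub>R k) - f (x + \<tau> *\<^sub>R h) - f (x + \<tau> *\<^sub>R k) + f x) / \<tau>\<^sup>2) (h \<bullet> (H *v k)) < e"
    using d B by (intro eventually_at_rightI[of 0 "d / B"]) auto
qed

text \<open>The second difference is symmetric in h and k, hence so is its limit.
  \<open>C21_with\<close> does not contain symmetry of the Hessian, which the cone demands.\<close>

lemma hessian_symmetric:
  fixes f :: "real^'n \<Rightarrow> real"
  assumes S: "open S" "x \<in> S"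
    and f: "\<And>y. y \<in> S \<Longrightarrow> (f has_derivative (\<lambda>h. Df y \<bullet> h)) (at y)"
    and Df: "(Df has_derivative (\<lambda>h. H *v h)) (at x)"
  shows "transpose H = H"
proof -
  have sym: "h \<bullet> (H *v k) = k \<bullet> (H *v h)" for h k
  proof (rule tendsto_unique[OF _ second_difference_tendsto[OF assms]])
    show "((\<lambda>\<tau>. (f (x + \<tau> *\<^sub>R h + \<tau> *\<^sub>R k) - f (x + \<tau> *\<^sub>R h) - f (x + \<tau> *\<^sub>R k) + f x) / \<tau>\<^sup>2)
          \<longlongrightarrow> k \<bullet> (H *v h)) (at_right 0)"
      using second_difference_tendsto[OF assms, of k h] by (simp add: algebra_simps)
  qed simp
  show ?thesis
    using sym[of "axis _ 1" "axis _ 1"]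
    by (simp add: vec_eq_iff transpose_def matrix_vector_mult_basis inner_axis' column_def)
qed

text \<open>If <h, Hh> > 0, the derivative along x + \<open>\<tau>\<close> h, zero at
  \<open>\<tau>\<close> = 0, is positive just afterwards, and f would exceed its maximum.\<close>

lemma hessian_at_max:
  fixes f :: "real^'n \<Rightarrow> real"
  assumes S: "open S" "x \<in> S"
    and f: "\<And>y. y \<in> S \<Longrightarrow> (f has_derivative (\<lambda>h. Df y \<bullet> h)) (at y)"
    and Df: "(Df has_derivative (\<lambda>h. H *v h)) (at x)"
    and max: "\<And>y. y \<in> S \<Longrightarrow> f y \<le> f x"
  shows "psd (- H)"
proof -
  have "h \<bullet> (H *v h) \<le> 0" for h
  proof (rule ccontr)
    assume "\<not> h \<bullet> (H *v h) \<le> 0"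
    then have pos: "(H *v h) \<bullet> h > 0" by (simp add: inner_commute)
    have "open ((\<lambda>\<tau>. x + \<tau> *\<^sub>R h) -` S)"
      by (intro open_vimage S continuous_intros)
    moreover have "0 \<in> (\<lambda>\<tau>. x + \<tau> *\<^sub>R h) -` S" using S(2) by simp
    ultimately obtain d where "d > 0" "ball 0 d \<subseteq> (\<lambda>\<tau>. x + \<tau> *\<^sub>R h) -` S"
      by (rule openE)
    then have d: "d > 0" "\<And>\<tau>. \<bar>\<tau>\<bar> < d \<Longrightarrow> x + \<tau> *\<^sub>R h \<in> S"
      by (auto simp: subset_iff)
    let ?g = "\<lambda>\<tau>. f (x + \<tau> *\<^sub>R h)" and ?g' = "\<lambda>\<tau>. Df (x + \<tau> *\<^sub>R h) \<bullet> h"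
    have g: "(?g has_real_derivative ?g' \<tau>) (at \<tau>)" if "\<bar>\<tau>\<bar> < d" for \<tau>
      using d(2)[OF that] by (intro DERIV_along_line f)
    have g0: "?g' 0 = 0"
      by (rule DERIV_local_max[OF g[of 0] d(1)]) (use d max in auto)
    have lin: "((\<lambda>\<tau>. x + \<tau> *\<^sub>R h) has_derivative (\<lambda>r. r *\<^sub>R h)) (at 0)"
      by (auto intro!: derivative_eq_intros)
    have "(Df has_derivative (\<lambda>h. H *v h)) (at (x + 0 *\<^sub>R h))" using Df by simp
    then have "((\<lambda>\<tau>. Df (x + \<tau> *\<^sub>R h)) has_derivative (\<lambda>r. H *v (r *\<^sub>R h))) (at 0)"
      by (rule has_derivative_compose[OF lin, of Df "\<lambda>h. H *v h"])
    then have "(?g' has_derivative (\<lambda>r. (H *v (r *\<^sub>R h)) \<bullet> h)) (at 0)"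
      by (rule has_derivative_inner_left)
    then have "(?g' has_real_derivative (H *v h) \<bullet> h) (at 0)"
      by (simp add: has_field_derivative_def matrix_vector_mult_scaleR mult_commute_abs)
    from DERIV_pos_inc_right[OF this pos] obtain d' where
      d': "d' > 0" "\<And>\<tau>. 0 < \<tau> \<Longrightarrow> \<tau> < d' \<Longrightarrow> ?g' \<tau> > 0" using g0 by auto
    define \<tau> where "\<tau> = min d d' / 2"
    have \<tau>: "0 < \<tau>" "\<tau> < d" "\<tau> < d'" using d d' by (auto simp: \<tau>_def)
    have "\<exists>\<xi>>0. \<xi> < \<tau> \<and> ?g \<tau> - ?g 0 = (\<tau> - 0) * ?g' \<xi>"
      by (rule MVT2[OF \<tau>(1)]) (use \<tau> in \<open>auto intro!: g\<close>)
    then obtain \<xi> where \<xi>: "0 < \<xi>" "\<xi> < \<tau>" "?g \<tau> - ?g 0 = \<tau> * ?g' \<xi>" by auto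
    then have "\<tau> * ?g' \<xi> > 0" using d'(2)[of \<xi>] \<tau> by simp
    then show False using max[OF d(2)[of \<tau>]] \<tau> \<xi>(3) by simp
  qed
  moreover have "transpose (- H) = - H"
    using hessian_symmetric[OF S f Df] by (simp add: transpose_def vec_eq_iff)
  moreover have "(- H) *v h = - (H *v h)" for h
    using scaleR_matrix_vector_assoc[of "-1" H h] by simp
  ultimately show ?thesis by (simp add: psd_def)
qed

text \<open>The equation only provides derivatives for positive times; at the initial time they are
  recovered from the continuous extension.\<close>

lemma has_derivative_initial_time:
  fixes w :: "'a::euclidean_space \<Rightarrow> real \<Rightarrow> 'b::banach" and A :: "'a \<Rightarrow> real \<Rightarrow> 'c::real_normed_vector"
  assumes B: "bounded_bilinear B" and \<Omega>: "open \<Omega>" "x \<in> \<Omega>"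
    and der: "\<And>y t. y \<in> \<Omega> \<Longrightarrow> t > 0 \<Longrightarrow> ((\<lambda>y. w y t) has_derivative (\<lambda>h. B (A y t) h)) (at y)"
    and cw: "continuous_on (\<Omega> \<times> {0..}) (\<lambda>(x, t). w x t)"
    and cA: "continuous_on (\<Omega> \<times> {0..}) (\<lambda>(x, t). A x t)"
  shows "((\<lambda>y. w y 0) has_derivative (\<lambda>h. B (A x 0) h)) (at x)"
proof -
  obtain r where r: "r > 0" "cball x r \<subseteq> \<Omega>" using \<Omega> open_contains_cball by blast
  have in\<Omega>: "y \<in> \<Omega>" if "y \<in> cball x r" for y using that r by blast
  define t where "t = (\<lambda>n. 1 / real (Suc n))"
  have t: "t n > 0" "t n \<le> 1" for n by (auto simp: t_def)
  have t0: "t \<longlonglongrightarrow> 0" unfolding t_def by (rule LIMSEQ_Suc[OF lim_1_over_n])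
  obtain K where K: "K > 0" "\<And>a b. norm (B a b) \<le> norm a * norm b * K"
    using bounded_bilinear.pos_bounded[OF B] by blast
  have lim: "(\<lambda>n. w y (t n)) \<longlonglongrightarrow> w y 0" if "y \<in> cball x r" for y
  proof -
    have "continuous_on {0..} (\<lambda>s. w y s)"
    proof -
      have "continuous_on {0..} (\<lambda>s::real. (y, s))"
        by (rule continuous_on_Pair[OF continuous_on_const continuous_on_id])
      moreover have "y \<in> \<Omega>" using that r by blast
      ultimately show ?thesis using continuous_on_compose2[OF cw, of "{0..}" "\<lambda>s. (y, s)"] by auto
    qed
    then show ?thesis
      by (rule continuous_on_tendsto_compose[OF _ t0]) (auto simp: t less_imp_le)
  qed
  \<comment> \<open>Limit of derivatives: uniform continuity of \<open>A\<close> on the ball times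
    [0, 1] makes the derivatives at the times \<open>t n\<close> converge uniformly. The bilinear
    \<open>B\<close> covers both the gradient and the Hessian.\<close>
  have "\<exists>g. \<forall>y\<in>cball x r. (\<lambda>n. w y (t n)) \<longlonglongrightarrow> g y \<and> (g has_derivative (\<lambda>h. B (A y 0) h)) (at y within cball x r)"
  proof (rule has_derivative_sequence)
    show "convex (cball x r)" "x \<in> cball x r" using r by auto
    show "(\<lambda>n. w x (t n)) \<longlonglongrightarrow> w x 0" using lim r by simp
    show "((\<lambda>y. w y (t n)) has_derivative (\<lambda>h. B (A y (t n)) h)) (at y within cball x r)"
      if "y \<in> cball x r" for n y
      by (rule has_derivative_at_withinI[OF der[OF in\<Omega>[OF that] t(1)]])
    fix e :: real assume e: "e > 0"
    have "uniformly_continuous_on (cball x r \<times> {0..1}) (\<lambda>(x, t). A x t)"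
      using r by (intro compact_uniformly_continuous continuous_on_subset[OF cA] compact_Times) auto
    then obtain d where d: "d > 0"
      "\<And>p q. p \<in> cball x r \<times> {0..1} \<Longrightarrow> q \<in> cball x r \<times> {0..1} \<Longrightarrow> dist q p < d \<Longrightarrow>
         dist (case q of (x, t) \<Rightarrow> A x t) (case p of (x, t) \<Rightarrow> A x t) < e / K"
      using e K unfolding uniformly_continuous_on_def by (metis divide_pos_pos)
    have "\<forall>\<^sub>F n in sequentially. t n < d" using order_tendstoD(2)[OF t0] d by simp
    then show "\<forall>\<^sub>F n in sequentially. \<forall>y\<in>cball x r. \<forall>h. norm (B (A y (t n)) h - B (A y 0) h) \<le> e * norm h"
    proof eventually_elim
      case (elim n)
      show ?case
      proof (intro ballI allI)
        fix y h assume y: "y \<in> cball x r"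
        have "dist (A y (t n)) (A y 0) < e / K"
          using d(2)[of "(y, 0)" "(y, t n)"] y elim t[of n] by (simp add: dist_Pair_Pair)
        then have "norm (A y (t n) - A y 0) * K \<le> e" using K by (simp add: dist_norm field_simps)
        moreover have "norm (B (A y (t n) - A y 0) h) \<le> norm (A y (t n) - A y 0) * norm h * K" by (rule K)
        ultimately have "norm (B (A y (t n) - A y 0) h) \<le> e * norm h"
          by (smt (verit) mult.commute mult.left_commute mult_right_mono norm_ge_zero)
        then show "norm (B (A y (t n)) h - B (A y 0) h) \<le> e * norm h"
          by (simp add: bounded_bilinear.diff_left[OF B])
      qed
    qed
  qed
  then obtain g where g: "\<And>y. y \<in> cball x r \<Longrightarrow> (\<lambda>n. w y (t n)) \<longlonglongrightarrow> g y"
    "(g has_derivative (\<lambda>h. B (A x 0) h)) (at x within cball x r)" using r by force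
  have "g y = w y 0" if "y \<in> cball x r" for y using LIMSEQ_unique[OF g(1) lim] that by blast
  then have "((\<lambda>y. w y 0) has_derivative (\<lambda>h. B (A x 0) h)) (at x within cball x r)"
    using r by (intro has_derivative_transform[OF _ _ g(2)]) auto
  moreover have "at x within cball x r = at x" using r by (intro at_within_interior) auto
  ultimately show ?thesis by simp
qed

text \<open>The equation enters only through \<open>no_touch\<close>, a contradiction at a positive
  interior maximum, so the nonlinear operator is never linearised.\<close>

lemma parabolic_maximum_principle:
  fixes w :: "real^'n \<Rightarrow> real \<Rightarrow> real"
  assumes \<Omega>: "open \<Omega>" "bounded \<Omega>"
    and cw: "continuous_on (closure \<Omega> \<times> {t0..}) (\<lambda>(x, t). w x t)"
    and der: "\<And>x t. x \<in> \<Omega> \<Longrightarrow> t > t0 \<Longrightarrow> ((\<lambda>y. w y t) has_derivative (\<lambda>h. Dw x t \<bullet> h)) (at x)"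
      "\<And>x t. x \<in> \<Omega> \<Longrightarrow> t > t0 \<Longrightarrow> ((\<lambda>y. Dw y t) has_derivative (\<lambda>h. Hw x t *v h)) (at x)"
      "\<And>x t. x \<in> \<Omega> \<Longrightarrow> t > t0 \<Longrightarrow> ((\<lambda>s. w x s) has_real_derivative Wt x t) (at t)"
    and init: "\<And>x. x \<in> closure \<Omega> \<Longrightarrow> w x t0 \<le> 0"
    and bdry: "\<And>x t. x \<in> frontier \<Omega> \<Longrightarrow> t \<ge> t0 \<Longrightarrow> w x t \<le> 0"
    and no_touch: "\<And>x t. x \<in> \<Omega> \<Longrightarrow> t > t0 \<Longrightarrow> w x t > 0 \<Longrightarrow> Wt x t \<ge> 0 \<Longrightarrow> psd (- Hw x t) \<Longrightarrow> False"
    and x1: "x1 \<in> closure \<Omega>" and t1: "t1 \<ge> t0"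
  shows "w x1 t1 \<le> 0"
proof (rule ccontr)
  assume pos: "\<not> w x1 t1 \<le> 0"
  have "\<exists>p\<in>closure \<Omega> \<times> {t0..t1}. \<forall>q\<in>closure \<Omega> \<times> {t0..t1}. (\<lambda>(x, t). w x t) q \<le> (\<lambda>(x, t). w x t) p"
    using x1 t1 \<Omega> by (intro continuous_attains_sup continuous_on_subset[OF cw] compact_Times) auto
  then obtain x t where xt: "x \<in> closure \<Omega>" "t0 \<le> t" "t \<le> t1"
    and max: "\<And>y s. y \<in> closure \<Omega> \<Longrightarrow> t0 \<le> s \<Longrightarrow> s \<le> t1 \<Longrightarrow> w y s \<le> w x t" by force
  have wpos: "w x t > 0" using max[OF x1 t1] pos by simp
  have "x \<notin> frontier \<Omega>" using bdry xt wpos by force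
  then have x: "x \<in> \<Omega>" using xt(1) \<Omega>(1) by (simp add: frontier_def interior_open)
  have t: "t > t0" using init[OF xt(1)] wpos xt by (cases "t = t0") auto
  \<comment> \<open>The maximum runs over times up to \<open>t1\<close> and may be attained at
    \<open>t1\<close> itself, so comparison with earlier times yields only this inequality.\<close>
  have "Wt x t \<ge> 0"
  proof (rule ccontr)
    assume "\<not> Wt x t \<ge> 0"
    with DERIV_neg_dec_left[OF der(3)[OF x t]] obtain d where
      d: "d > 0" "\<And>h. 0 < h \<Longrightarrow> h < d \<Longrightarrow> w x t < w x (t - h)" by force
    define h where "h = min d (t - t0) / 2"
    have "0 < h" "h < d" "h < t - t0" using d t by (auto simp: h_def min_def)
    then show False using d(2)[of h] max[OF xt(1), of "t - h"] xt by simp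
  qed
  moreover have "psd (- Hw x t)"
    by (rule hessian_at_max[OF \<Omega>(1) x der(1)[OF _ t] der(2)[OF x t]])
       (use max xt closure_subset in auto)
  ultimately show False using no_touch[OF x t wpos] by blast
qed

section \<open>Comparison with barriers\<close>

text \<open>Meant for \<open>S\<close> the Hessian of \<open>U\<close> and \<open>S1\<close> that of
  \<open>u\<close> at a maximum of u - U - s g. Monotonicity leads from (a, S1) to (s/(2m), S - s
  I). The step from S - s I to S gains s/m T_{m-1}(S), half of which covers the time term because
  T_{m-1}(S - s I) <= T_{m-1}(S).\<close>

lemma upper_barrier:
  fixes S S1 :: "real^'n^'n"
  assumes m: "1 \<le> m" "m \<le> CARD('n)" and c: "garding_cone m a S1" and s: "s \<ge> 0"
    and P: "psd (S - s *\<^sub>R mat 1 - S1)" and a: "a \<le> s / (2 * m)"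
  shows "gE m a S1 \<le> gT m S - s / (2 * m) * gT (m - 1) S"
proof -
  let ?S = "S - s *\<^sub>R mat 1"
  have c': "garding_cone m (s / (2 * m)) ?S"
    using cone_mono[OF m c P, of "s / (2 * m) - a"] a by simp
  have "gE m a S1 \<le> gE m (s / (2 * m)) ?S"
    using cone_gE_mono[OF m c P, of "s / (2 * m) - a"] a by simp
  moreover have "s / (2 * m) * gT (m - 1) ?S \<le> s / (2 * m) * gT (m - 1) S"
    using cone_gT_mono(2)[OF m c' s] s by (intro mult_left_mono) auto
  moreover have "gT m ?S + 2 * (s / (2 * m) * gT (m - 1) S) \<le> gT m S"
    using cone_gT_increment[OF m c' s] by simp
  ultimately show ?thesis by (simp add: gE_def)
qed

text \<open>Now the smaller pair is built from \<open>S\<close>, so its membership in the cone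
  cannot come from \<open>S1\<close>. It is propagated from (0, S) along
  (-\<open>\<sigma>\<close>/(2m), S + \<open>\<sigma>\<close> I), where the increment estimate keeps
  the operator positive.\<close>

lemma lower_barrier:
  fixes S S1 :: "real^'n^'n"
  assumes m: "1 \<le> m" "m \<le> CARD('n)" and c: "garding_cone m 0 S" and s: "s \<ge> 0"
    and P: "psd (S1 - (S + s *\<^sub>R mat 1))" and a: "- s / (2 * m) \<le> a"
  shows "gT m S + s / (2 * m) * gT (m - 1) S \<le> gE m a S1"
proof -
  let ?S = "\<lambda>\<sigma>. S + \<sigma> *\<^sub>R mat 1"
  have E: "gT m S + \<sigma> / (2 * m) * gT (m - 1) S \<le> gE m (- \<sigma> / (2 * m)) (?S \<sigma>)"
    and nn: "\<sigma> / (2 * m) * gT (m - 1) S \<ge> 0" if "\<sigma> \<ge> 0" for \<sigma>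
  proof -
    have "\<sigma> / (2 * m) * gT (m - 1) S \<le> \<sigma> / (2 * m) * gT (m - 1) (?S \<sigma>)"
      using cone_gT_mono(2)[OF m c that] that by (intro mult_left_mono) auto
    moreover have "gT m S + 2 * (\<sigma> / (2 * m) * gT (m - 1) (?S \<sigma>)) \<le> gT m (?S \<sigma>)"
      using cone_gT_increment[OF m c that] by simp
    ultimately show "gT m S + \<sigma> / (2 * m) * gT (m - 1) S \<le> gE m (- \<sigma> / (2 * m)) (?S \<sigma>)"
      by (simp add: gE_def)
    show "\<sigma> / (2 * m) * gT (m - 1) S \<ge> 0"
      using cone_gT_mono(1)[OF m c that] that by simp
  qed
  have pos: "gT m S > 0" using cone_gE_pos[OF c] by (simp add: gE_def)
  have c': "garding_cone m (- s / (2 * m)) (?S s)"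
  proof (rule dcone_connected[OF m posdef_mat1, of 1 "{0..s}" "\<lambda>\<sigma>. - \<sigma> / (2 * m)" ?S 0 s])
    show "gE m (- \<sigma> / (2 * m)) (?S \<sigma>) > 0" if "\<sigma> \<in> {0..s}" for \<sigma>
      using E[of \<sigma>] nn[of \<sigma>] pos that by auto
    show "transpose (?S \<sigma>) = ?S \<sigma>" if "\<sigma> \<in> {0..s}" for \<sigma>
      using cone_sym[OF cone_shift[OF c, of \<sigma>]] that by simp
    show "continuous_on {0..s} (\<lambda>\<sigma>. - \<sigma> / real (2 * m))" using m by (intro continuous_intros) auto
  qed (use c s in \<open>auto intro!: continuous_intros\<close>)
  have "gE m (- s / (2 * m)) (?S s) \<le> gE m a S1"
    using cone_gE_mono[OF m c' P, of "a - (- s / (2 * m))"] a by simp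
  then show ?thesis using E[OF s] by simp
qed

lemma bounded_bilinear_matrix_vector_mult:
  "bounded_bilinear ((*v) :: real^'n^'m \<Rightarrow> real^'n \<Rightarrow> real^'m)"
proof -
  have "bilinear ((*v) :: real^'n^'m \<Rightarrow> real^'n \<Rightarrow> real^'m)"
    unfolding bilinear_def
    by (auto intro!: linearI simp: matrix_vector_mult_add_rdistrib matrix_vector_right_distrib
        scaleR_matrix_vector_assoc matrix_vector_mult_scaleR)
  then show ?thesis by (simp add: bilinear_conv_bounded_bilinear)
qed

lemma gradient_unique:
  fixes D D' :: "real^'n"
  assumes "(f has_derivative (\<lambda>h. D \<bullet> h)) (at x)" "(f has_derivative (\<lambda>h. D' \<bullet> h)) (at x)"
  shows "D = D'"
proof -
  have "D \<bullet> h = D' \<bullet> h" for h using fun_cong[OF has_derivative_unique[OF assms], of h] .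
  then show ?thesis using vector_eq_rdot by blast
qed

lemma jacobian_unique:
  fixes H H' :: "real^'n^'m"
  assumes "(f has_derivative (\<lambda>h. H *v h)) (at x)" "(f has_derivative (\<lambda>h. H' *v h)) (at x)"
  shows "H = H'"
proof -
  have "H *v h = H' *v h" for h using fun_cong[OF has_derivative_unique[OF assms], of h] .
  then show ?thesis by (simp add: matrix_eq)
qed

text \<open>The cone is entered at (x0, 0): there the Hessian of \<open>u\<close> is that of the
  initial datum, and the lower bound on the operator extends to t = 0 by continuity, so
  \<open>cone_of_positive\<close> applies.\<close>

lemma solution_in_cone:
  fixes u :: "real^'n \<Rightarrow> real \<Rightarrow> real"
  assumes m: "1 \<le> m" "m \<le> CARD('n)" and \<Omega>: "open \<Omega>" "connected \<Omega>"
    and u: "C21_with \<Omega> u Du Hu Ut" and \<nu>: "\<nu> > 0"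
    and E: "\<And>x t. x \<in> \<Omega> \<Longrightarrow> t > 0 \<Longrightarrow> gE m (- Ut x t) (Hu x t) \<ge> \<nu>"
    and D\<psi>: "\<And>x. x \<in> \<Omega> \<Longrightarrow> ((\<lambda>y. u y 0) has_derivative (\<lambda>h. D\<psi> x \<bullet> h)) (at x)"
    and H\<psi>: "\<And>x. x \<in> \<Omega> \<Longrightarrow> (D\<psi> has_derivative (\<lambda>h. H\<psi> x *v h)) (at x)"
    and x0: "x0 \<in> \<Omega>" "\<And>p. p \<in> {1..m - 1} \<Longrightarrow> gT p (H\<psi> x0) > 0"
    and x: "x \<in> \<Omega>" and t: "t \<ge> 0"
  shows "garding_cone m (- Ut x t) (Hu x t)"
proof -
  have sub: "\<Omega> \<times> {0..} \<subseteq> closure \<Omega> \<times> {0::real..}" using closure_subset by auto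
  have cu: "continuous_on (\<Omega> \<times> {0..}) (\<lambda>(x, t). u x t)"
    and cDu: "continuous_on (\<Omega> \<times> {0..}) (\<lambda>(x, t). Du x t)"
    and cHu: "continuous_on (\<Omega> \<times> {0..}) (\<lambda>(x, t). Hu x t)"
    and cUt: "continuous_on (\<Omega> \<times> {0..}) (\<lambda>(x, t). Ut x t)"
    using u unfolding C21_with_def by (auto intro: continuous_on_subset[OF _ sub])
  have du: "((\<lambda>y. u y t) has_derivative (\<lambda>h. Du x t \<bullet> h)) (at x)"
    and dDu: "((\<lambda>y. Du y t) has_derivative (\<lambda>h. Hu x t *v h)) (at x)"
    if "x \<in> \<Omega>" "t > 0" for x t using u that unfolding C21_with_def by auto
  have du0: "((\<lambda>y. u y 0) has_derivative (\<lambda>h. Du x 0 \<bullet> h)) (at x)" if "x \<in> \<Omega>" for x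
    by (rule has_derivative_initial_time[OF bounded_bilinear_inner \<Omega>(1) that du cu cDu])
  have dDu0: "((\<lambda>y. Du y 0) has_derivative (\<lambda>h. Hu x 0 *v h)) (at x)" if "x \<in> \<Omega>" for x
    by (rule has_derivative_initial_time[OF bounded_bilinear_matrix_vector_mult \<Omega>(1) that dDu cDu cHu])
  have sym: "transpose (Hu x t) = Hu x t" if "x \<in> \<Omega>" "t \<ge> 0" for x t
  proof (cases "t = 0")
    case True
    then show ?thesis using hessian_symmetric[OF \<Omega>(1) that(1) du0 dDu0] that by simp
  next
    case False
    then have "t > 0" using that by simp
    from hessian_symmetric[OF \<Omega>(1) that(1) du[OF _ this] dDu[OF that(1) this]] show ?thesis .
  qed
  have cE: "continuous_on (\<Omega> \<times> {0..}) (\<lambda>p. gE m (- Ut (fst p) (snd p)) (Hu (fst p) (snd p)))"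
    using cUt cHu by (intro continuous_intros) (auto simp: case_prod_beta')
  have E0: "gE m (- Ut x t) (Hu x t) \<ge> \<nu>" if "x \<in> \<Omega>" "t \<ge> 0" for x t
  proof (cases "t = 0")
    case True
    have "continuous_on {0..} (\<lambda>s::real. (x, s))"
      by (rule continuous_on_Pair[OF continuous_on_const continuous_on_id])
    then have "continuous_on {0..} (\<lambda>s. gE m (- Ut x s) (Hu x s))"
      using continuous_on_compose2[OF cE, of "{0..}" "\<lambda>s. (x, s)"] that by auto
    then have c: "continuous_on (closure {0<..}) (\<lambda>s. gE m (- Ut x s) (Hu x s))" by simp
    have "gE m (- Ut x 0) (Hu x 0) \<ge> \<nu>"
      using continuous_ge_on_closure[OF c, of 0 \<nu>] E that by simp
    then show ?thesis using True by simp
  qed (use E that in simp)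
  have "Du y 0 = D\<psi> y" if "y \<in> \<Omega>" for y
    using gradient_unique[OF du0[OF that] D\<psi>[OF that]] .
  then have "((\<lambda>y. Du y 0) has_derivative (\<lambda>h. H\<psi> x0 *v h)) (at x0)"
    by (intro has_derivative_transform_within_open[OF H\<psi>[OF x0(1)] \<Omega>(1) x0(1)]) simp
  then have H0: "Hu x0 0 = H\<psi> x0" using jacobian_unique[OF dDu0[OF x0(1)]] by simp
  have c0: "garding_cone m (- Ut x0 0) (Hu x0 0)"
    using x0 sym[OF x0(1), of 0] E0[OF x0(1), of 0] \<nu> by (intro cone_of_positive[OF m]) (auto simp: H0)
  have "garding_cone m (- Ut (fst (x, t)) (snd (x, t))) (Hu (fst (x, t)) (snd (x, t)))"
  proof (rule dcone_connected[OF m posdef_mat1, of 1 "\<Omega> \<times> {0..}"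
        "\<lambda>p. - Ut (fst p) (snd p)" "\<lambda>p. Hu (fst p) (snd p)" "(x0, 0)"])
    show "connected (\<Omega> \<times> {0::real..})" using \<Omega> by (intro connected_Times) auto
    show "continuous_on (\<Omega> \<times> {0..}) (\<lambda>p. - Ut (fst p) (snd p))"
      "continuous_on (\<Omega> \<times> {0..}) (\<lambda>p. Hu (fst p) (snd p))"
      using cUt cHu by (auto simp: case_prod_beta' intro!: continuous_intros)
    show "transpose (Hu (fst p) (snd p)) = Hu (fst p) (snd p)" if "p \<in> \<Omega> \<times> {0..}" for p
      using that sym by auto
    show "gE m (- Ut (fst p) (snd p)) (Hu (fst p) (snd p)) > 0" if "p \<in> \<Omega> \<times> {0..}" for p
      using that E0[of "fst p" "snd p"] \<nu> by auto
  qed (use x0 x t c0 in auto)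
  then show ?thesis by simp
qed

lemma K_imp_cone:
  fixes S :: "real^'n^'n"
  assumes m: "1 \<le> m" "m \<le> CARD('n)" and "S \<in> K m"
  shows "garding_cone m 0 S"
proof (rule cone_of_positive[OF m])
  show "transpose S = S" "\<And>p. p \<in> {1..m - 1} \<Longrightarrow> gT p S > 0" "gE m 0 S > 0"
    using assms by (auto simp: K_def T_eq_gT gE_def)
qed


theorem theorem3p1:
  fixes \<Omega> :: "(real^'n) set"
    and m :: nat
    and f :: "real^'n \<Rightarrow> real \<Rightarrow> real"
    and \<phi> :: "real^'n \<Rightarrow> real \<Rightarrow> real"
    and u :: "real^'n \<Rightarrow> real \<Rightarrow> real"
    and F :: "real^'n \<Rightarrow> real"
    and \<Phi> :: "real^'n \<Rightarrow> real"
    and U :: "real^'n \<Rightarrow> real"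
  assumes dom: "open \<Omega>" "connected \<Omega>" "bounded \<Omega>" "\<Omega> \<noteq> {}"
    and m: "1 \<le> m" "m \<le> CARD('n)"
    and F_cont: "continuous_on (closure \<Omega>) F"
    and \<Phi>_cont: "continuous_on (frontier \<Omega>) \<Phi>"
    and f_lower: "\<exists>\<nu>>0. \<forall>x\<in>closure \<Omega>. \<forall>t\<ge>0. f x t \<ge> \<nu>"
    and \<phi>_init: "\<exists>D\<phi> H\<phi>.
          (\<forall>x\<in>\<Omega>. ((\<lambda>y. \<phi> y 0) has_derivative (\<lambda>h. D\<phi> x \<bullet> h)) (at x) \<and>
                   (D\<phi> has_derivative (\<lambda>h. H\<phi> x *v h)) (at x)) \<and>
          continuous_on \<Omega> D\<phi> \<and> continuous_on \<Omega> H\<phi> \<and>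
          (\<exists>x0\<in>\<Omega>. k_positive (m - 1) (H\<phi> x0))"
    and u_sol: "\<exists>Du Hu Ut. C21_with \<Omega> u Du Hu Ut \<and>
          (\<forall>x\<in>\<Omega>. \<forall>t>0. - Ut x t * T (m - 1) (Hu x t) + T m (Hu x t) = f x t)"
    and u_bdry: "\<forall>x\<in>\<Omega>. u x 0 = \<phi> x 0"
                "\<forall>x\<in>frontier \<Omega>. \<forall>t\<ge>0. u x t = \<phi> x t"
    and U_sol: "\<exists>DU HU. C2_with \<Omega> U DU HU \<and>
          (\<forall>x\<in>closure \<Omega>. HU x \<in> K m) \<and>
          (\<forall>x\<in>\<Omega>. T m (HU x) = F x)"
    and U_bdry: "\<forall>x\<in>frontier \<Omega>. U x = \<Phi> x"
    and f_conv: "uniform_limit (closure \<Omega>) (\<lambda>t x. f x t) F at_top"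
    and \<phi>_conv: "uniform_limit (frontier \<Omega>) (\<lambda>t x. \<phi> x t) \<Phi> at_top"
  shows "uniform_limit (closure \<Omega>) (\<lambda>t x. u x t) U at_top"
proof -
  obtain D\<phi> H\<phi> x0 where D\<phi>: "\<And>x. x \<in> \<Omega> \<Longrightarrow> ((\<lambda>y. \<phi> y 0) has_derivative (\<lambda>h. D\<phi> x \<bullet> h)) (at x)"
    and H\<phi>: "\<And>x. x \<in> \<Omega> \<Longrightarrow> (D\<phi> has_derivative (\<lambda>h. H\<phi> x *v h)) (at x)"
    and x0: "x0 \<in> \<Omega>" "k_positive (m - 1) (H\<phi> x0)"
    using \<phi>_init by blast
  obtain Du Hu Ut where u: "C21_with \<Omega> u Du Hu Ut"
    and u_eq: "\<And>x t. x \<in> \<Omega> \<Longrightarrow> t > 0 \<Longrightarrow> - Ut x t * T (m - 1) (Hu x t) + T m (Hu x t) = f x t"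
    using u_sol by blast
  obtain DU HU where U: "C2_with \<Omega> U DU HU"
    and HU_K: "\<And>x. x \<in> closure \<Omega> \<Longrightarrow> HU x \<in> K m"
    and U_eq: "\<And>x. x \<in> \<Omega> \<Longrightarrow> T m (HU x) = F x"
    using U_sol by blast
  obtain \<nu> where \<nu>: "\<nu> > 0" "\<And>x t. x \<in> closure \<Omega> \<Longrightarrow> t \<ge> 0 \<Longrightarrow> f x t \<ge> \<nu>" using f_lower by blast
  have closure: "\<Omega> \<subseteq> closure \<Omega>" "compact (closure \<Omega>)" "closure \<Omega> \<noteq> {}"
    using dom closure_subset by auto
  have E_eq: "gE m (- Ut x t) (Hu x t) = f x t" if "x \<in> \<Omega>" "t > 0" for x t
    using u_eq[OF that] by (simp add: gE_def T_eq_gT)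
  have cone_u: "garding_cone m (- Ut x t) (Hu x t)" if "x \<in> \<Omega>" "t \<ge> 0" for x t
  proof (rule solution_in_cone[OF m dom(1,2) u \<nu>(1) _ _ H\<phi> x0(1) _ that])
    show "gE m (- Ut x t) (Hu x t) \<ge> \<nu>" if "x \<in> \<Omega>" "t > 0" for x t
      using E_eq[OF that] \<nu>(2)[of x t] that closure(1) by auto
    show "((\<lambda>y. u y 0) has_derivative (\<lambda>h. D\<phi> x \<bullet> h)) (at x)" if "x \<in> \<Omega>" for x
      by (rule has_derivative_transform_within_open[OF D\<phi>[OF that] dom(1) that]) (use u_bdry in simp)
    show "gT p (H\<phi> x0) > 0" if "p \<in> {1..m - 1}" for p
      using x0(2) that by (auto simp: k_positive_def K_def T_eq_gT)
  qed
  have cone_U: "garding_cone m 0 (HU x)" if "x \<in> closure \<Omega>" for x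
    using K_imp_cone[OF m HU_K[OF that]] .

  have cu: "continuous_on (closure \<Omega> \<times> {0..}) (\<lambda>(x, t). u x t)"
    and du: "\<And>x t. x \<in> \<Omega> \<Longrightarrow> t > 0 \<Longrightarrow> ((\<lambda>y. u y t) has_derivative (\<lambda>h. Du x t \<bullet> h)) (at x)"
      "\<And>x t. x \<in> \<Omega> \<Longrightarrow> t > 0 \<Longrightarrow> ((\<lambda>y. Du y t) has_derivative (\<lambda>h. Hu x t *v h)) (at x)"
      "\<And>x t. x \<in> \<Omega> \<Longrightarrow> t > 0 \<Longrightarrow> ((\<lambda>s. u x s) has_real_derivative Ut x t) (at t)"
    using u unfolding C21_with_def by auto
  have cU: "continuous_on (closure \<Omega>) U" "continuous_on (closure \<Omega>) HU"
    and dU: "\<And>x. x \<in> \<Omega> \<Longrightarrow> (U has_derivative (\<lambda>h. DU x \<bullet> h)) (at x)"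
      "\<And>x. x \<in> \<Omega> \<Longrightarrow> (DU has_derivative (\<lambda>h. HU x *v h)) (at x)"
    using U unfolding C2_with_def by auto

  \<comment> \<open>Weight and constants of the barriers\<close>
  have "bounded (closure \<Omega>)" using closure(2) compact_imp_bounded by blast
  then obtain R where R: "\<And>x. x \<in> closure \<Omega> \<Longrightarrow> norm x \<le> R" unfolding bounded_iff by blast
  \<comment> \<open>The Hessian of \<open>g\<close> is -I, so subtracting s g adds s I to the
    Hessian of the difference; the summand 1 gives g >= 1, so that s g >= s on the closure.\<close>
  define g :: "real^'n \<Rightarrow> real" where "g = (\<lambda>x. 1 + (R\<^sup>2 - x \<bullet> x) / 2)"
  define G where "G = 1 + R\<^sup>2 / 2"
  have g: "1 \<le> g x" "g x \<le> G" if "x \<in> closure \<Omega>" for x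
  proof -
    have "x \<bullet> x \<le> R\<^sup>2" using R[OF that] by (simp add: dot_square_norm power_mono)
    then show "1 \<le> g x" "g x \<le> G" by (simp_all add: g_def G_def)
  qed
  have G: "G \<ge> 1" by (simp add: G_def)
  have dg: "(g has_derivative (\<lambda>h. (- x) \<bullet> h)) (at x)" for x
    unfolding g_def by (auto intro!: derivative_eq_intros simp: inner_commute)
  have cg: "continuous_on A g" for A unfolding g_def by (intro continuous_intros) simp

  \<comment> \<open>The reserve must be uniform in x: admissibility up to the boundary and
    compactness give a positive minimum of T_{m-1}, while T_0 = 1 settles m = 1.\<close>
  have "\<exists>x\<in>closure \<Omega>. \<forall>y\<in>closure \<Omega>. gT (m - 1) (HU x) \<le> gT (m - 1) (HU y)"
    using closure cU by (intro continuous_attains_inf continuous_intros)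
  then obtain z where z: "z \<in> closure \<Omega>" "\<And>y. y \<in> closure \<Omega> \<Longrightarrow> gT (m - 1) (HU z) \<le> gT (m - 1) (HU y)"
    by blast
  define c where "c = gT (m - 1) (HU z)"
  have c: "c > 0"
  proof (cases "m = 1")
    case False
    then show ?thesis using HU_K[OF z(1)] m(1) by (simp add: K_def c_def T_eq_gT)
  qed (simp add: c_def)
  define \<kappa> where "\<kappa> = 1 / (2 * m * G)"
  have \<kappa>: "\<kappa> > 0" using m(1) G by (simp add: \<kappa>_def)

  show ?thesis
  proof (rule uniform_limitI)
    fix e :: real assume e: "e > 0"
    \<comment> \<open>Then s(t) G tends to \<open>\<epsilon>\<close> G = e/2, below e.\<close>
    define \<epsilon> where "\<epsilon> = e / (2 * G)"
    have \<epsilon>: "\<epsilon> > 0" using e G by (simp add: \<epsilon>_def)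
    \<comment> \<open>The first entry is the margin on the boundary, where s g >=
      \<open>\<epsilon>\<close>; the second is the least remaining gain in the interior.\<close>
    define \<delta> where "\<delta> = min \<epsilon> (\<epsilon> / (2 * m) * c)"
    have \<delta>: "\<delta> > 0" using \<epsilon> c m(1) by (simp add: \<delta>_def)
    have "\<forall>\<^sub>F t in at_top. t > 0 \<and> (\<forall>x\<in>closure \<Omega>. dist (f x t) (F x) < \<delta>) \<and>
        (\<forall>x\<in>frontier \<Omega>. dist (\<phi> x t) (\<Phi> x) < \<delta>)"
      using uniform_limitD[OF f_conv \<delta>] uniform_limitD[OF \<phi>_conv \<delta>] eventually_gt_at_top[of "0::real"]
      by eventually_elim auto
    then obtain t0 where t0': "\<And>t. t \<ge> t0 \<Longrightarrow> t > 0 \<and> (\<forall>x\<in>closure \<Omega>. dist (f x t) (F x) < \<delta>) \<and>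
        (\<forall>x\<in>frontier \<Omega>. dist (\<phi> x t) (\<Phi> x) < \<delta>)"
      unfolding eventually_at_top_linorder by blast
    have t0: "t0 > 0" using t0'[of t0] by simp
    have f_close: "\<bar>f x t - F x\<bar> < \<delta>" if "x \<in> closure \<Omega>" "t \<ge> t0" for x t
      using t0'[OF that(2)] that(1) by (auto simp: dist_real_def)
    have u_close: "\<bar>u x t - U x\<bar> < \<delta>" if "x \<in> frontier \<Omega>" "t \<ge> t0" for x t
      using t0'[OF that(2)] that t0 u_bdry(2) U_bdry by (auto simp: dist_real_def)
    have "continuous_on (closure \<Omega>) (\<lambda>x. (x, t0))"
      by (rule continuous_on_Pair[OF continuous_on_id continuous_on_const])
    moreover have "(\<lambda>x. (x, t0)) ` closure \<Omega> \<subseteq> closure \<Omega> \<times> {0..}" using t0 by auto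
    ultimately have cu_slice: "continuous_on (closure \<Omega>) (\<lambda>x. u x t0)"
      using continuous_on_compose2[OF cu, of "closure \<Omega>" "\<lambda>x. (x, t0)"] by simp
    \<comment> \<open>The largest error at time \<open>t0\<close> becomes the amplitude
      \<open>M\<close>, so that the barriers enclose \<open>u\<close> initially.\<close>
    have "\<exists>x\<in>closure \<Omega>. \<forall>y\<in>closure \<Omega>. \<bar>u y t0 - U y\<bar> \<le> \<bar>u x t0 - U x\<bar>"
      using closure cU cu_slice by (intro continuous_attains_sup continuous_intros)
    then obtain M where M: "M \<ge> 0" "\<And>y. y \<in> closure \<Omega> \<Longrightarrow> \<bar>u y t0 - U y\<bar> \<le> M"
      by (metis abs_ge_zero)
    define s where "s = (\<lambda>t. \<epsilon> + M * exp (- \<kappa> * (t - t0)))"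
    define s' where "s' = (\<lambda>t. - \<kappa> * M * exp (- \<kappa> * (t - t0)))"
    have ds: "(s has_real_derivative s' t) (at t)" for t
      unfolding s_def s'_def by (auto intro!: derivative_eq_intros)
    have cs: "continuous_on A s" for A unfolding s_def by (intro continuous_intros)
    have s: "\<epsilon> \<le> s t" "0 \<le> s t" for t using \<epsilon> M(1) by (auto simp: s_def)
    have s't: "- s' t * g x \<le> s t / (2 * m)" if "x \<in> closure \<Omega>" for x t
    proof -
      have "- s' t * g x \<le> (\<kappa> * s t) * G"
        using g[OF that] \<kappa> \<epsilon> M(1) G by (intro mult_mono) (auto simp: s_def s'_def algebra_simps)
      also have "\<dots> = s t / (2 * m)" using G by (simp add: \<kappa>_def)
      finally show ?thesis .
    qed
    have gap: "\<delta> \<le> s t / (2 * m) * gT (m - 1) (HU x)" if "x \<in> closure \<Omega>" for x t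
    proof -
      have "\<delta> \<le> \<epsilon> / (2 * m) * c" by (simp add: \<delta>_def)
      also have "\<dots> \<le> s t / (2 * m) * gT (m - 1) (HU x)"
        using s[of t] z(2)[OF that] c by (intro mult_mono divide_right_mono) (auto simp: c_def)
      finally show ?thesis .
    qed
    have sg: "\<epsilon> \<le> s t * g x" if "x \<in> closure \<Omega>" for x t
      using mult_mono[OF s(1)[of t] g(1)[OF that]] s(2)[of t] by simp
    have sg0: "M \<le> s t0 * g x" if "x \<in> closure \<Omega>" for x
      using mult_mono[of M "s t0" 1 "g x"] g(1)[OF that] s(2)[of t0] \<epsilon> by (simp add: s_def)

    have sub: "closure \<Omega> \<times> {t0..} \<subseteq> closure \<Omega> \<times> {0..}" using t0 by auto
    have cu': "continuous_on (closure \<Omega> \<times> {t0..}) (\<lambda>p. u (fst p) (snd p))"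
      using continuous_on_subset[OF cu sub] by (simp add: case_prod_beta')
    have cU': "continuous_on (closure \<Omega> \<times> {t0..}) (\<lambda>p. U (fst p))"
      by (rule continuous_on_compose2[OF cU(1)]) (auto intro!: continuous_intros)
    have cg': "continuous_on (closure \<Omega> \<times> {t0..}) (\<lambda>p. g (fst p))"
      by (rule continuous_on_compose2[OF cg[of UNIV]]) (auto intro!: continuous_intros)
    have cs': "continuous_on (closure \<Omega> \<times> {t0..}) (\<lambda>p. s (snd p))"
      by (rule continuous_on_compose2[OF cs[of UNIV]]) (auto intro!: continuous_intros)

    have mat_mult: "(s t *\<^sub>R mat 1) *v h = s t *\<^sub>R h" for t and h :: "real^'n"
      by (simp add: scaleR_matrix_vector_assoc[symmetric])

    \<comment> \<open>Comparison from above and from below\<close>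
    have upper: "u x t - U x - s t * g x \<le> 0" if "x \<in> closure \<Omega>" "t \<ge> t0" for x t
    proof (rule parabolic_maximum_principle[OF dom(1,3), where ?t0.0 = t0
          and w = "\<lambda>x t. u x t - U x - s t * g x"
          and Dw = "\<lambda>x t. Du x t - DU x + s t *\<^sub>R x"
          and Hw = "\<lambda>x t. Hu x t - HU x + s t *\<^sub>R mat 1"
          and Wt = "\<lambda>x t. Ut x t - s' t * g x"])
      show "continuous_on (closure \<Omega> \<times> {t0..}) (\<lambda>(x, t). u x t - U x - s t * g x)"
        unfolding case_prod_beta' by (intro continuous_intros cu' cU' cg' cs')
      show "((\<lambda>y. u y t - U y - s t * g y) has_derivative (\<lambda>h. (Du x t - DU x + s t *\<^sub>R x) \<bullet> h)) (at x)"
        if "x \<in> \<Omega>" "t > t0" for x t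
        using that t0
        by (auto intro!: derivative_eq_intros du(1) dU(1) dg simp: inner_diff_left inner_add_left)
      show "((\<lambda>y. Du y t - DU y + s t *\<^sub>R y) has_derivative (\<lambda>h. (Hu x t - HU x + s t *\<^sub>R mat 1) *v h)) (at x)"
        if "x \<in> \<Omega>" "t > t0" for x t
        using that t0
        by (auto intro!: derivative_eq_intros du(2) dU(2)
            simp: matrix_vector_mult_add_rdistrib matrix_vector_mult_diff_rdistrib mat_mult)
      show "((\<lambda>r. u x r - U x - s r * g x) has_real_derivative Ut x t - s' t * g x) (at t)"
        if "x \<in> \<Omega>" "t > t0" for x t
        using that t0 by (auto intro!: derivative_eq_intros du(3) ds)
      show "u x t0 - U x - s t0 * g x \<le> 0" if "x \<in> closure \<Omega>" for x
        using M(2)[OF that] sg0[OF that] by linarith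
      show "u x t - U x - s t * g x \<le> 0" if "x \<in> frontier \<Omega>" "t \<ge> t0" for x t
        using u_close[OF that] sg[of x t] that(1) by (auto simp: \<delta>_def frontier_def)
      \<comment> \<open>Here u_t >= s' g and Hu <= HU - s I, so the upper barrier gives f <= F -
        \<open>\<delta>\<close>, against the choice of \<open>t0\<close>.\<close>
      show False if x: "x \<in> \<Omega>" and t: "t > t0" and Wt: "Ut x t - s' t * g x \<ge> 0"
        and H: "psd (- (Hu x t - HU x + s t *\<^sub>R mat 1))" for x t
      proof -
        have xc: "x \<in> closure \<Omega>" using x closure(1) by blast
        have "gE m (- Ut x t) (Hu x t) \<le> gT m (HU x) - s t / (2 * m) * gT (m - 1) (HU x)"
        proof (rule upper_barrier[OF m cone_u[OF x] s(2)])
          show "psd (HU x - s t *\<^sub>R mat 1 - Hu x t)" using H by (simp add: algebra_simps)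
          show "- Ut x t \<le> s t / (2 * m)" using Wt s't[OF xc, of t] by linarith
        qed (use t t0 in simp)
        then have "f x t \<le> F x - \<delta>"
          using E_eq[OF x, of t] U_eq[OF x] gap[OF xc, of t] t t0 by (simp add: T_eq_gT)
        then show False using f_close[OF xc, of t] t by linarith
      qed
    qed (fact that)+

    have lower: "U x - u x t - s t * g x \<le> 0" if "x \<in> closure \<Omega>" "t \<ge> t0" for x t
    proof (rule parabolic_maximum_principle[OF dom(1,3), where ?t0.0 = t0
          and w = "\<lambda>x t. U x - u x t - s t * g x"
          and Dw = "\<lambda>x t. DU x - Du x t + s t *\<^sub>R x"
          and Hw = "\<lambda>x t. HU x - Hu x t + s t *\<^sub>R mat 1"
          and Wt = "\<lambda>x t. - Ut x t - s' t * g x"])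
      show "continuous_on (closure \<Omega> \<times> {t0..}) (\<lambda>(x, t). U x - u x t - s t * g x)"
        unfolding case_prod_beta' by (intro continuous_intros cu' cU' cg' cs')
      show "((\<lambda>y. U y - u y t - s t * g y) has_derivative (\<lambda>h. (DU x - Du x t + s t *\<^sub>R x) \<bullet> h)) (at x)"
        if "x \<in> \<Omega>" "t > t0" for x t
        using that t0
        by (auto intro!: derivative_eq_intros du(1) dU(1) dg simp: inner_diff_left inner_add_left)
      show "((\<lambda>y. DU y - Du y t + s t *\<^sub>R y) has_derivative (\<lambda>h. (HU x - Hu x t + s t *\<^sub>R mat 1) *v h)) (at x)"
        if "x \<in> \<Omega>" "t > t0" for x t
        using that t0
        by (auto intro!: derivative_eq_intros du(2) dU(2)
            simp: matrix_vector_mult_add_rdistrib matrix_vector_mult_diff_rdistrib mat_mult)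
      show "((\<lambda>r. U x - u x r - s r * g x) has_real_derivative - Ut x t - s' t * g x) (at t)"
        if "x \<in> \<Omega>" "t > t0" for x t
        using that t0 by (auto intro!: derivative_eq_intros du(3) ds)
      show "U x - u x t0 - s t0 * g x \<le> 0" if "x \<in> closure \<Omega>" for x
        using M(2)[OF that] sg0[OF that] by linarith
      show "U x - u x t - s t * g x \<le> 0" if "x \<in> frontier \<Omega>" "t \<ge> t0" for x t
        using u_close[OF that] sg[of x t] that(1) by (auto simp: \<delta>_def frontier_def)
      \<comment> \<open>Here -u_t >= s' g and Hu >= HU + s I, so the lower barrier gives f >= F +
        \<open>\<delta>\<close>.\<close>
      show False if x: "x \<in> \<Omega>" and t: "t > t0" and Wt: "- Ut x t - s' t * g x \<ge> 0"
        and H: "psd (- (HU x - Hu x t + s t *\<^sub>R mat 1))" for x t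
      proof -
        have xc: "x \<in> closure \<Omega>" using x closure(1) by blast
        have "gT m (HU x) + s t / (2 * m) * gT (m - 1) (HU x) \<le> gE m (- Ut x t) (Hu x t)"
        proof (rule lower_barrier[OF m cone_U[OF xc] s(2)])
          show "psd (Hu x t - (HU x + s t *\<^sub>R mat 1))" using H by (simp add: algebra_simps)
          have "- (s t / (2 * m)) \<le> - Ut x t" using Wt s't[OF xc, of t] by linarith
          then show "- s t / (2 * m) \<le> - Ut x t" by simp
        qed
        then have "F x + \<delta> \<le> f x t"
          using E_eq[OF x, of t] U_eq[OF x] gap[OF xc, of t] t t0 by (simp add: T_eq_gT)
        then show False using f_close[OF xc, of t] t by linarith
      qed
    qed (fact that)+

    \<comment> \<open>Decay of the barriers as time grows\<close>
    have "((\<lambda>t. (\<epsilon> + M * exp (- \<kappa> * (t - t0))) * G) \<longlongrightarrow> (\<epsilon> + M * 0) * G) at_top"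
    proof (intro tendsto_intros)
      have "filterlim (\<lambda>t. \<kappa> * (t + - t0)) at_top at_top"
        using \<kappa> by (intro filterlim_tendsto_pos_mult_at_top[OF tendsto_const] 
            filterlim_tendsto_add_at_top[OF tendsto_const filterlim_ident, of "- t0", simplified add.commute])
      then have "filterlim (\<lambda>t. - \<kappa> * (t - t0)) at_bot at_top"
        by (simp add: filterlim_uminus_at_top)
      then show "((\<lambda>t. exp (- \<kappa> * (t - t0))) \<longlongrightarrow> 0) at_top"
        by (rule filterlim_compose[OF exp_at_bot])
    qed
    moreover have "(\<epsilon> + M * 0) * G < e" using e G by (simp add: \<epsilon>_def)
    ultimately have "\<forall>\<^sub>F t in at_top. s t * G < e"
      unfolding s_def by (rule order_tendstoD(2))
    then show "\<forall>\<^sub>F t in at_top. \<forall>x\<in>closure \<Omega>. dist (u x t) (U x) < e"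
      using eventually_ge_at_top[of t0]
    proof eventually_elim
      case (elim t)
      show ?case
      proof
        fix x assume x: "x \<in> closure \<Omega>"
        have "s t * g x \<le> s t * G" using g(2)[OF x] s(2) by (intro mult_left_mono)
        then show "dist (u x t) (U x) < e"
          using upper[OF x elim(2)] lower[OF x elim(2)] elim(1) by (simp add: dist_real_def)
      qed
    qed
  qed
qed

end
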